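(* Let $p$ be a prime and $n\ge2$ with $p>n+1$, and let $G$ be the pro-$p$ Iwahori subgroup of $SL_n(\mathbb{Z}_p)$ equipped with the function $\omega$ defined below. Let $g_1,\dots,g_d$ ($d=|\Phi|+|\Pi|$) be the elements $$\{x_\beta(p),\ h_\delta(1+p),\ x_\alpha(1)\ :\ \beta\in\Phi^-,\ \delta\in\Pi,\ \alpha\in\Phi^+\}$$ listed in the following order: (i) first the $x_\beta(p)$, $\beta\in\Phi^-$, in order of increasing height (roots of equal height in increasing column index, i.e. $(n,1),(n-1,1),(n,2),\dots$); (ii) then $h_{(1,2)}(1+p),h_{(2,3)}(1+p),\dots,h_{(n-1,n)}(1+p)$; (iii) finally the $x_\alpha(1)$, $\alpha\in\Phi^+$, where $x_{(i,j)}(1)$ comes before $x_{(k,l)}(1)$ if and only if $i>k$, or $i=k$ and $j>l$. Then $g_1,\dots,g_d$ is an ordered basis of $(G,\omega)$, i.e. the map $\mathbb{Z}_p^d\to G$, $(z_1,\dots,z_d)\mapsto g_1^{z_1}\cdots g_d^{z_d}$ is a bijection and $$\omega(g_1^{z_1}\cdots g_d^{z_d})=\min_{1\le i\le d}\big(\omega(g_i)+\mathrm{val}_p(z_i)\big)\quad\text{for all }(z_1,\dots,z_d)\in\mathbb{Z}_p^d.$$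
   Context: $G$ is the group of matrices in $SL_n(\mathbb{Z}_p)$ which are upper unipotent modulo $p$. Roots: $\Phi=\{(i,j):1\le i\ne j\le n\}$, $\Phi^+=\{(i,j):i<j\}$, $\Phi^-=\{(i,j):i>j\}$, $\Pi=\{(i,i+1)\}$; the height of $(i,j)$ is $j-i$. $E_{i,j}$ is the elementary matrix; $x_{(i,j)}(t)=I+tE_{i,j}$; for $\delta=(i,i+1)$, $h_\delta(\lambda)$ is diagonal with $\lambda$ at $(i,i)$, $\lambda^{-1}$ at $(i+1,i+1)$ and $1$ elsewhere. The $p$-valuation $\omega$ on $G$: for $g=(a_{ij})\in G$, $$\omega(g)=\min\Big(\min_{i\ne j}\big(\tfrac{j-i}{n}+\mathrm{val}_p(a_{ij})\big),\ \min_i \mathrm{val}_p(a_{ii}-1)\Big).$$ *)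

theory Defs
  imports
    "HOL-Library.Extended_Real"
    "Jordan_Normal_Form.Determinant"
    "Berlekamp_Zassenhaus.Finite_Field"
begin

section \<open>The ring of p-adic integers\<close>

text \<open>
  The prime is \<open>p = CARD('p)\<close>. A p-adic integer is a point of the inverse limit of the rings
  \<open>\<int>/p\<^sup>k\<int>\<close>: \<open>padic_res x k\<close> is the representative in \<open>{0..<p^k}\<close> of \<open>x\<close> modulo \<open>p^k\<close>.
\<close>

typedef (overloaded) ('p::prime_card) padic_int =
  "{x :: nat \<Rightarrow> int. \<forall>k. x k = x (Suc k) mod int CARD('p) ^ k}"
  morphisms padic_res Abs_padic_int
  by (rule exI[of _ "\<lambda>_. 0"]) simp

setup_lifting type_definition_padic_int

lemma padic_int_pos [simp]: "0 < int CARD('p::prime_card)"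
  using prime_card[where 'a='p] prime_gt_0_nat by simp

lemma padic_int_gt_1: "1 < int CARD('p::prime_card)"
  using prime_card[where 'a='p] prime_gt_1_nat by fastforce

lemma mod_mod_power_Suc: "(a mod q ^ Suc k) mod q ^ k = a mod q ^ k" for a q :: int
  by (rule mod_mod_cancel) simp

lemma padic_int_eqI: "(\<And>k. padic_res x k = padic_res y k) \<Longrightarrow> x = y"
  by (rule iffD1[OF padic_res_inject], rule ext)

lemma padic_res_Suc: "padic_res x (Suc k) mod int CARD('p) ^ k = padic_res x k"
  for x :: "'p::prime_card padic_int"
proof -
  have "\<forall>k. padic_res x k = padic_res x (Suc k) mod int CARD('p) ^ k"
    using padic_res[of x] by (rule CollectD)
  then show ?thesis
    by (rule allE) (erule sym)
qed

lemma padic_res_mod [simp]: "padic_res x k mod int CARD('p) ^ k = padic_res x k"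
  for x :: "'p::prime_card padic_int"
  by (subst (1 2) padic_res_Suc[symmetric]) (rule mod_mod_trivial)

lemma padic_compat_add:
  fixes x y q :: int
  assumes x: "x = x' mod q ^ k" and y: "y = y' mod q ^ k"
  shows "(x + y) mod q ^ k = (x' + y') mod q ^ Suc k mod q ^ k"
  by (simp only: x y mod_add_eq mod_mod_power_Suc)

lemma padic_compat_diff:
  fixes x y q :: int
  assumes x: "x = x' mod q ^ k" and y: "y = y' mod q ^ k"
  shows "(x - y) mod q ^ k = (x' - y') mod q ^ Suc k mod q ^ k"
  by (simp only: x y mod_diff_eq mod_mod_power_Suc)

lemma padic_compat_mult:
  fixes x y q :: int
  assumes x: "x = x' mod q ^ k" and y: "y = y' mod q ^ k"
  shows "(x * y) mod q ^ k = (x' * y') mod q ^ Suc k mod q ^ k"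
  by (simp only: x y mod_mult_eq mod_mod_power_Suc)

lemma padic_compat_minus:
  fixes x q :: int
  assumes x: "x = x' mod q ^ k"
  shows "(- x) mod q ^ k = (- x') mod q ^ Suc k mod q ^ k"
  by (simp only: x mod_minus_eq mod_mod_power_Suc)

instantiation padic_int :: (prime_card) comm_ring_1
begin

lift_definition zero_padic_int :: "'a padic_int" is "\<lambda>_. 0"
  by simp

lift_definition one_padic_int :: "'a padic_int" is "\<lambda>k. 1 mod int CARD('a) ^ k"
  by (simp only: mod_mod_power_Suc)

lift_definition plus_padic_int :: "'a padic_int \<Rightarrow> 'a padic_int \<Rightarrow> 'a padic_int"
  is "\<lambda>x y k. (x k + y k) mod int CARD('a) ^ k"
  by (rule padic_compat_add) blast+

lift_definition minus_padic_int :: "'a padic_int \<Rightarrow> 'a padic_int \<Rightarrow> 'a padic_int"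
  is "\<lambda>x y k. (x k - y k) mod int CARD('a) ^ k"
  by (rule padic_compat_diff) blast+

lift_definition uminus_padic_int :: "'a padic_int \<Rightarrow> 'a padic_int"
  is "\<lambda>x k. (- x k) mod int CARD('a) ^ k"
  by (rule padic_compat_minus) blast+

lift_definition times_padic_int :: "'a padic_int \<Rightarrow> 'a padic_int \<Rightarrow> 'a padic_int"
  is "\<lambda>x y k. (x k * y k) mod int CARD('a) ^ k"
  by (rule padic_compat_mult) blast+

instance
proof
  note rep = zero_padic_int.rep_eq one_padic_int.rep_eq plus_padic_int.rep_eq
    minus_padic_int.rep_eq uminus_padic_int.rep_eq times_padic_int.rep_eq
  fix a b c :: "'a padic_int"
  show "a + b + c = a + (b + c)"
    by (rule padic_int_eqI) (simp add: rep mod_simps algebra_simps)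
  show "a + b = b + a"
    by (rule padic_int_eqI) (simp add: rep algebra_simps)
  show "0 + a = a"
    by (rule padic_int_eqI) (simp add: rep)
  show "- a + a = 0"
    by (rule padic_int_eqI) (simp add: rep mod_simps)
  show "a - b = a + - b"
    by (rule padic_int_eqI) (simp add: rep mod_simps)
  show "a * b * c = a * (b * c)"
    by (rule padic_int_eqI) (simp add: rep mod_simps algebra_simps)
  show "a * b = b * a"
    by (rule padic_int_eqI) (simp add: rep algebra_simps)
  show "1 * a = a"
    by (rule padic_int_eqI) (simp add: rep mod_simps)
  show "(a + b) * c = a * c + b * c"
    by (rule padic_int_eqI) (simp add: rep mod_simps algebra_simps)
  have "padic_res (0 :: 'a padic_int) 1 \<noteq> padic_res 1 1"
    using padic_int_gt_1[where 'p='a] by (simp add: rep)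
  then show "(0 :: 'a padic_int) \<noteq> 1"
    by metis
qed

end

definition padic_prime :: "'p::prime_card padic_int"
  where "padic_prime = of_nat CARD('p)"

definition padic_val :: "'p::prime_card padic_int \<Rightarrow> enat"
  where "padic_val x = (if x = 0 then \<infinity> else enat (GREATEST k. padic_prime ^ k dvd x))"

lemma padic_res_add: "padic_res x (k + m) mod int CARD('p) ^ k = padic_res x k"
  for x :: "'p::prime_card padic_int"
proof (induction m)
  case (Suc m)
  have "padic_res x (k + Suc m) mod int CARD('p) ^ k
      = (padic_res x (Suc (k + m)) mod int CARD('p) ^ (k + m)) mod int CARD('p) ^ k"
    by (simp add: mod_mod_cancel le_imp_power_dvd)
  then show ?case
    using Suc by (simp only: padic_res_Suc)
qed simp

lemma padic_res_of_nat: "padic_res (of_nat m :: 'p::prime_card padic_int) k = int m mod int CARD('p) ^ k"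
proof (induction m)
  case (Suc m)
  then show ?case
    by (simp add: plus_padic_int.rep_eq one_padic_int.rep_eq mod_simps)
qed (simp add: zero_padic_int.rep_eq)

lemma padic_res_prime_power:
  "padic_res (padic_prime ^ k :: 'p::prime_card padic_int) m = int CARD('p) ^ k mod int CARD('p) ^ m"
  using padic_res_of_nat[of "CARD('p) ^ k" m, where 'p='p] by (simp add: padic_prime_def)

lemma padic_prime_power_dvd_iff: "padic_prime ^ k dvd x \<longleftrightarrow> padic_res x k = 0"
  for x :: "'p::prime_card padic_int"
proof
  assume "padic_prime ^ k dvd x"
  then obtain y where "x = padic_prime ^ k * y" ..
  then show "padic_res x k = 0"
    by (simp add: times_padic_int.rep_eq padic_res_prime_power)
next
  assume 0: "padic_res x k = 0"
  let ?q = "int CARD('p)"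
  have dvd: "?q ^ k dvd padic_res x (k + m)" for m
    using padic_res_add[of x k m] 0 by (simp add: dvd_eq_mod_eq_0)
  define f where "f = (\<lambda>m. padic_res x (k + m) div ?q ^ k)"
  have xf: "padic_res x (k + m) = ?q ^ k * f m" for m
    using dvd[of m] by (simp add: f_def)
  have fS: "f m = f (Suc m) mod ?q ^ m" for m
  proof -
    have "?q ^ k * (f (Suc m) mod ?q ^ m) = (?q ^ k * f (Suc m)) mod ?q ^ (k + m)"
      by (simp only: mult_mod_right power_add)
    also have "\<dots> = ?q ^ k * f m"
      using padic_res_Suc[of x "k + m"] by (simp only: xf add_Suc_right[symmetric])
    finally show ?thesis
      by simp
  qed
  then have f: "f \<in> {x. \<forall>k. x k = x (Suc k) mod ?q ^ k}"
    by blast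
  define y :: "'p padic_int" where "y = Abs_padic_int f"
  have y: "padic_res y = f"
    unfolding y_def by (rule Abs_padic_int_inverse[OF f])
  have "padic_res x m = padic_res (padic_prime ^ k * y) m" for m
  proof -
    have "padic_res x m = padic_res x (m + k) mod ?q ^ m"
      by (simp only: padic_res_add)
    also have "\<dots> = (?q ^ k * f m) mod ?q ^ m"
      by (simp only: xf add.commute[of m k])
    also have "\<dots> = padic_res (padic_prime ^ k * y) m"
      by (simp add: times_padic_int.rep_eq padic_res_prime_power y mod_simps)
    finally show ?thesis .
  qed
  then have "x = padic_prime ^ k * y"
    by (rule padic_int_eqI)
  then show "padic_prime ^ k dvd x" ..
qed

lemma padic_val_ge_iff: "enat k \<le> padic_val x \<longleftrightarrow> padic_prime ^ k dvd x"
  for x :: "'p::prime_card padic_int"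
proof (cases "x = 0")
  case False
  then obtain m where m: "padic_res x m \<noteq> 0"
    using padic_int_eqI[of x 0] by (auto simp: zero_padic_int.rep_eq)
  have bnd: "j \<le> m" if "padic_prime ^ j dvd x" for j
  proof (rule ccontr)
    assume "\<not> j \<le> m"
    then have "m \<le> j"
      by simp
    from dvd_trans[OF le_imp_power_dvd[OF this] that] show False
      using m padic_prime_power_dvd_iff by blast
  qed
  have "padic_prime ^ (GREATEST j. padic_prime ^ j dvd x) dvd x"
    by (rule GreatestI_nat[where k = 0 and b = m]) (auto intro: bnd)
  moreover have "k \<le> (GREATEST j. padic_prime ^ j dvd x)" if "padic_prime ^ k dvd x"
    by (rule Greatest_le_nat[where b = m]) (use that bnd in auto)
  moreover have "padic_prime ^ k dvd x"
    if "k \<le> j" "padic_prime ^ j dvd x" for j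
    by (rule dvd_trans[OF le_imp_power_dvd[OF that(1)] that(2)])
  ultimately show ?thesis
    using False by (auto simp: padic_val_def)
qed (simp add: padic_val_def)

lemma padic_val_diff_commute: "padic_val (x - y) = padic_val (y - x)"
proof -
  have "padic_prime ^ k dvd x - y \<longleftrightarrow> padic_prime ^ k dvd y - x" for k
    using dvd_minus_iff[of "padic_prime ^ k" "x - y"] by (simp only: minus_diff_eq)
  then show ?thesis
    unfolding padic_val_def by (simp only: right_minus_eq eq_commute[of x y])
qed

instantiation padic_int :: (prime_card) metric_space
begin

definition dist_padic_int :: "'a padic_int \<Rightarrow> 'a padic_int \<Rightarrow> real"
  where "dist x y = (if x = y then 0 else (1 / real CARD('a)) ^ the_enat (padic_val (x - y)))"

definition uniformity_padic_int :: "('a padic_int \<times> 'a padic_int) filter"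
  where "uniformity_padic_int = (INF e\<in>{0 <..}. principal {(x, y). dist x y < e})"

definition open_padic_int :: "'a padic_int set \<Rightarrow> bool"
  where "open_padic_int U = (\<forall>x\<in>U. eventually (\<lambda>(x', y). x' = x \<longrightarrow> y \<in> U) uniformity)"

instance
proof
  have p1: "1 < real CARD('a)"
    using padic_int_gt_1[where 'p='a] by simp
  have ex: "\<exists>k. padic_val x = enat k" if "x \<noteq> 0" for x :: "'a padic_int"
    using that by (simp add: padic_val_def)
  fix x y z :: "'a padic_int"
  show "dist x y = 0 \<longleftrightarrow> x = y"
    using p1 by (simp add: dist_padic_int_def)
  show "dist x y \<le> dist x z + dist y z"
  proof (cases "x = y \<or> x = z \<or> y = z")
    case True
    then consider "x = y" | "x = z" | "y = z"
      by blast
    then show ?thesis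
    proof cases
      case 1
      then show ?thesis
        by (simp add: dist_padic_int_def)
    next
      case 2
      then show ?thesis
        by (simp add: dist_padic_int_def padic_val_diff_commute[of y z])
    next
      case 3
      then show ?thesis
        by (simp add: dist_padic_int_def)
    qed
  next
    case False
    then have ne: "x - y \<noteq> 0" "x - z \<noteq> 0" "y - z \<noteq> 0"
      by (simp_all only: right_minus_eq de_Morgan_disj not_False_eq_True)
    obtain a where a: "padic_val (x - y) = enat a"
      using ex[OF ne(1)] ..
    obtain b where b: "padic_val (x - z) = enat b"
      using ex[OF ne(2)] ..
    obtain c where c: "padic_val (y - z) = enat c"
      using ex[OF ne(3)] ..
    note v = a b c
    have "padic_prime ^ min b c dvd (x - z) - (y - z)"
      by (rule dvd_diff) (simp_all add: padic_val_ge_iff[symmetric] v)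
    then have "min b c \<le> a"
      using padic_val_ge_iff[of "min b c" "x - y"] by (simp add: a)
    then have "(1 / real CARD('a)) ^ a \<le> (1 / real CARD('a)) ^ min b c"
      using p1 by (intro power_decreasing) auto
    also have "\<dots> \<le> (1 / real CARD('a)) ^ b + (1 / real CARD('a)) ^ c"
      by (simp add: min_def)
    finally show ?thesis
      using False v by (simp add: dist_padic_int_def)
  qed
qed (simp_all add: uniformity_padic_int_def open_padic_int_def)

end

definition unit_inv :: "'a::comm_ring_1 \<Rightarrow> 'a"
  where "unit_inv u = (THE v. u * v = 1)"


section \<open>Roots\<close>

text \<open>
  Rows and columns are numbered \<open>0, \<dots>, n - 1\<close>, as everywhere in \<^theory>\<open>Jordan_Normal_Form.Matrix\<close>.
  Heights and the orderings below are invariant under the shift from \<open>1, \<dots>, n\<close>.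
\<close>

definition roots :: "nat \<Rightarrow> (nat \<times> nat) set"
  where "roots n = {(i, j). i < n \<and> j < n \<and> i \<noteq> j}"

definition pos_roots :: "nat \<Rightarrow> (nat \<times> nat) set"
  where "pos_roots n = {(i, j) \<in> roots n. i < j}"

definition neg_roots :: "nat \<Rightarrow> (nat \<times> nat) set"
  where "neg_roots n = {(i, j) \<in> roots n. i > j}"

definition simple_roots :: "nat \<Rightarrow> (nat \<times> nat) set"
  where "simple_roots n = {(i, j) \<in> roots n. j = Suc i}"

definition height :: "nat \<times> nat \<Rightarrow> int"
  where "height = (\<lambda>(i, j). int j - int i)"

definition neg_root_list :: "nat \<Rightarrow> (nat \<times> nat) list"
  where "neg_root_list n = concat (map (\<lambda>m. map (\<lambda>j. (j + m, j)) [0..<n - m]) (rev [1..<n]))"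

definition simple_root_list :: "nat \<Rightarrow> (nat \<times> nat) list"
  where "simple_root_list n = map (\<lambda>i. (i, Suc i)) [0..<n - 1]"

definition pos_root_list :: "nat \<Rightarrow> (nat \<times> nat) list"
  where "pos_root_list n = concat (map (\<lambda>i. map (\<lambda>j. (i, j)) (rev [Suc i..<n])) (rev [0..<n]))"

lemma sorted_wrt_concat_map:
  assumes "\<And>x. x \<in> set xs \<Longrightarrow> sorted_wrt R (f x)"
    and "sorted_wrt S xs"
    and "\<And>x y a b. S x y \<Longrightarrow> a \<in> set (f x) \<Longrightarrow> b \<in> set (f y) \<Longrightarrow> R a b"
  shows "sorted_wrt R (concat (map f xs))"
  using assms(1,2)
proof (induction xs)
  case (Cons x xs)
  then show ?case
    using assms(3) by (auto simp: sorted_wrt_append)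
qed simp

lemma sorted_wrt_rev_upt: "sorted_wrt (>) (rev [i..<j])"
  by (simp add: sorted_wrt_rev)

lemma set_neg_root_list: "set (neg_root_list n) = neg_roots n"
proof -
  have "(i, j) \<in> set (neg_root_list n)" if "j < i" "i < n" for i j
  proof -
    have *: "i - j \<in> {1..<n}" "j \<in> {0..<n - (i - j)}" "(i, j) = (j + (i - j), j)"
      using that by auto
    show ?thesis
      unfolding neg_root_list_def set_concat set_map set_rev set_upt image_image
      by (rule UN_I[OF *(1)], rule image_eqI, rule *(3), rule *(2))
  qed
  then show ?thesis
    by (auto simp: neg_roots_def roots_def neg_root_list_def)
qed

lemma set_simple_root_list: "set (simple_root_list n) = simple_roots n"
  by (auto simp: simple_roots_def roots_def simple_root_list_def)

lemma set_pos_root_list: "set (pos_root_list n) = pos_roots n"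
  by (force simp: pos_roots_def roots_def pos_root_list_def)

lemma sorted_neg_root_list:
  "sorted_wrt (\<lambda>\<alpha> \<beta>. height \<alpha> < height \<beta> \<or> height \<alpha> = height \<beta> \<and> snd \<alpha> < snd \<beta>) (neg_root_list n)"
  unfolding neg_root_list_def
  by (rule sorted_wrt_concat_map[OF _ sorted_wrt_rev_upt])
    (auto simp: height_def sorted_wrt_map)

lemma sorted_simple_root_list: "sorted_wrt (\<lambda>\<alpha> \<beta>. fst \<alpha> < fst \<beta>) (simple_root_list n)"
  by (simp add: simple_root_list_def sorted_wrt_map)

lemma sorted_pos_root_list:
  "sorted_wrt (\<lambda>(i, j) (k, l). i > k \<or> i = k \<and> j > l) (pos_root_list n)"
  unfolding pos_root_list_def
  by (rule sorted_wrt_concat_map[OF _ sorted_wrt_rev_upt])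
    (auto simp: sorted_wrt_map sorted_wrt_rev)


section \<open>The pro-p Iwahori subgroup\<close>

definition pro_p_iwahori :: "nat \<Rightarrow> 'p::prime_card padic_int mat set"
  where "pro_p_iwahori n = {A \<in> carrier_mat n n. det A = 1 \<and>
    (\<forall>i<n. padic_prime dvd A $$ (i, i) - 1) \<and>
    (\<forall>i<n. \<forall>j<i. padic_prime dvd A $$ (i, j))}"

definition iwahori_val :: "nat \<Rightarrow> 'p::prime_card padic_int mat \<Rightarrow> ereal"
  where "iwahori_val n A = min
    (MIN (i, j)\<in>roots n. ereal (real_of_int (height (i, j)) / real n) + ereal_of_enat (padic_val (A $$ (i, j))))
    (MIN i\<in>{..<n}. ereal_of_enat (padic_val (A $$ (i, i) - 1)))"

definition root_elt :: "nat \<Rightarrow> nat \<times> nat \<Rightarrow> 'a::comm_ring_1 \<Rightarrow> 'a mat"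
  where "root_elt n \<alpha> t = 1\<^sub>m n + t \<cdot>\<^sub>m mat n n (\<lambda>ij. if ij = \<alpha> then 1 else 0)"

definition coroot_elt :: "nat \<Rightarrow> nat \<times> nat \<Rightarrow> 'a::comm_ring_1 \<Rightarrow> 'a mat"
  where "coroot_elt n \<delta> u = mat n n (\<lambda>(i, j).
    if i \<noteq> j then 0 else if i = fst \<delta> then u else if i = snd \<delta> then unit_inv u else 1)"

definition iwahori_gens :: "nat \<Rightarrow> 'p::prime_card padic_int mat list"
  where "iwahori_gens n =
    map (\<lambda>\<beta>. root_elt n \<beta> padic_prime) (neg_root_list n) @
    map (\<lambda>\<delta>. coroot_elt n \<delta> (1 + padic_prime)) (simple_root_list n) @
    map (\<lambda>\<alpha>. root_elt n \<alpha> 1) (pos_root_list n)"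


section \<open>Ordered bases\<close>

text \<open>
  The power \<open>g^z\<close> with a p-adic exponent is the limit of the powers \<open>g^(z mod p^k)\<close>, taken
  entry by entry. On \<^const>\<open>pro_p_iwahori\<close> the topology given by \<^const>\<open>iwahori_val\<close>
  is the entrywise p-adic one.
\<close>

definition padic_pow :: "'p::prime_card padic_int mat \<Rightarrow> 'p padic_int \<Rightarrow> 'p padic_int mat"
  where "padic_pow g z = mat (dim_row g) (dim_col g)
    (\<lambda>ij. lim (\<lambda>k. (g ^\<^sub>m nat (padic_res z k)) $$ ij))"

definition ordered_prod ::
  "nat \<Rightarrow> 'p::prime_card padic_int mat list \<Rightarrow> 'p padic_int vec \<Rightarrow> 'p padic_int mat"
  where "ordered_prod n gs z =
    foldr (\<lambda>i A. padic_pow (gs ! i) (z $ i) * A) [0..<length gs] (1\<^sub>m n)"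

definition ordered_basis ::
  "nat \<Rightarrow> 'p::prime_card padic_int mat set \<Rightarrow> ('p padic_int mat \<Rightarrow> ereal) \<Rightarrow>
    'p padic_int mat list \<Rightarrow> bool"
  where "ordered_basis n G w gs \<longleftrightarrow>
    bij_betw (ordered_prod n gs) (carrier_vec (length gs)) G \<and>
    (\<forall>z\<in>carrier_vec (length gs).
      w (ordered_prod n gs z) = (MIN i\<in>{..<length gs}. w (gs ! i) + ereal_of_enat (padic_val (z $ i))))"

end

theory Submission
  imports Defs
begin

text \<open>
  Filter matrices by \<open>L\<^sub>m = {X. val\<^sub>p(X\<^sub>i\<^sub>j) + (j - i)/n \<ge> m/n}\<close>; then \<open>L\<^sub>m L\<^sub>k \<subseteq> L\<^bsub>m+k\<^esub>\<close>,
  the condition \<open>\<omega>(g) \<ge> m/n\<close> says \<open>g - 1 \<in> L\<^sub>m\<close>, and every factor of the ordered product lies in \<open>1 + L\<^sub>1\<close>.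
  Hence, if all factors of two such products agree modulo \<open>L\<^sub>m\<close>, the difference of the products is modulo
  \<open>L\<^bsub>m+1\<^esub>\<close> just the sum of the differences of the factors. In suitable coordinates the ordered product is
  therefore a map \<open>F\<close> on \<open>L\<^sub>1\<close> with \<open>F C - F D \<equiv> C - D\<close> modulo \<open>L\<^bsub>m+1\<^esub>\<close> whenever \<open>C - D \<in> L\<^sub>m\<close>.
  Such a map preserves the filtration in both directions, which gives the formula for \<open>\<omega>\<close> and injectivity,
  and \<open>C \<mapsto> C - F C + A\<close> is a contraction, which gives surjectivity.
  The determinant condition is handled by adding one more torus factor \<open>diag(1, \<dots>, 1, u)\<close>: the product
  then ranges over all of \<open>1 + L\<^sub>1\<close> and has determinant \<open>u\<close>.
\<close>

section \<open>Divisibility and completeness in the p-adic integers\<close>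

lemma dvd_diff_swap: "a dvd b - c \<longleftrightarrow> a dvd c - b" for a b c :: "'a::comm_ring_1"
  using dvd_minus_iff[of a "b - c"] by simp

lemma padic_eq_0I:
  fixes x :: "'p::prime_card padic_int"
  assumes "\<And>k. padic_prime ^ k dvd x"
  shows "x = 0"
  by (rule padic_int_eqI) (use assms in \<open>simp add: padic_prime_power_dvd_iff zero_padic_int.rep_eq\<close>)

text \<open>Read modulo p^(k+1), the claim is cancellation of one factor p in the integers. It
  serves as the substitute for cancellation in a domain: p is not a zero divisor and raises the
  valuation by exactly one.\<close>

lemma padic_prime_mult_dvd_iff:
  fixes x :: "'p::prime_card padic_int"
  shows "padic_prime ^ Suc k dvd padic_prime * x \<longleftrightarrow> padic_prime ^ k dvd x"
proof
  let ?q = "int CARD('p)"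
  assume "padic_prime ^ Suc k dvd padic_prime * x"
  then have "padic_res (padic_prime ^ 1 * x) (Suc k) = 0"
    by (simp only: padic_prime_power_dvd_iff power_one_right)
  then have "(?q * padic_res x (Suc k)) mod ?q ^ Suc k = 0"
    unfolding times_padic_int.rep_eq padic_res_prime_power mod_mult_left_eq by simp
  then have "?q * ?q ^ k dvd ?q * padic_res x (Suc k)"
    by (simp only: dvd_eq_mod_eq_0 power_Suc)
  then have "?q ^ k dvd padic_res x (Suc k)"
    by simp
  then show "padic_prime ^ k dvd x"
    using padic_res_Suc[of x k] by (simp add: padic_prime_power_dvd_iff dvd_eq_mod_eq_0)
qed (simp add: mult_dvd_mono)

lemma padic_prime_mult_left_cancel:
  fixes x y :: "'p::prime_card padic_int"
  assumes "padic_prime * x = padic_prime * y"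
  shows "x = y"
proof -
  have "padic_prime ^ k dvd x - y" for k
    using assms padic_prime_mult_dvd_iff[of k "x - y"] by (simp add: right_diff_distrib)
  then show ?thesis
    using padic_eq_0I[of "x - y"] by simp
qed

lemma padic_prime_power_dvd_diff_iff:
  fixes x y :: "'p::prime_card padic_int"
  shows "padic_prime ^ k dvd x - y \<longleftrightarrow> padic_res x k = padic_res y k"
proof
  assume "padic_prime ^ k dvd x - y"
  then have "(padic_res x k - padic_res y k) mod int CARD('p) ^ k = 0"
    by (simp add: padic_prime_power_dvd_iff minus_padic_int.rep_eq)
  then have "padic_res x k mod int CARD('p) ^ k = padic_res y k mod int CARD('p) ^ k"
    by (simp only: mod_eq_dvd_iff dvd_eq_mod_eq_0)
  then show "padic_res x k = padic_res y k"
    by simp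
qed (simp add: padic_prime_power_dvd_iff minus_padic_int.rep_eq)

text \<open>The limit is read off diagonally: its residue modulo p^k is that of the k-th term, and
  the hypothesis is exactly the compatibility demanded of a point of the inverse limit.\<close>

lemma padic_complete:
  fixes y :: "nat \<Rightarrow> 'p::prime_card padic_int"
  assumes "\<And>k. padic_prime ^ k dvd y (Suc k) - y k"
  obtains l where "\<And>k. padic_prime ^ k dvd l - y k"
proof
  define f where "f k = padic_res (y k) k" for k
  have "f k = f (Suc k) mod int CARD('p) ^ k" for k
    using assms[of k] by (simp add: f_def padic_prime_power_dvd_diff_iff padic_res_Suc)
  then have "padic_res (Abs_padic_int f :: 'p padic_int) = f"
    by (intro Abs_padic_int_inverse) blast
  then show "padic_prime ^ k dvd Abs_padic_int f - y k" for k
    by (simp add: padic_prime_power_dvd_diff_iff f_def)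
qed

lemma padic_prime_power_dvd_res:
  fixes z :: "'p::prime_card padic_int"
  shows "padic_prime ^ k dvd z - of_nat (nat (padic_res z k))"
proof -
  have "0 \<le> padic_res z k"
    by (subst padic_res_mod[symmetric]) (rule pos_mod_sign, simp)
  then show ?thesis
    unfolding padic_prime_power_dvd_diff_iff padic_res_of_nat by simp
qed

lemma padic_tendstoI:
  fixes y :: "nat \<Rightarrow> 'p::prime_card padic_int"
  assumes "\<And>k. padic_prime ^ k dvd y k - l"
  shows "y \<longlonglongrightarrow> l"
proof (rule metric_LIMSEQ_I)
  let ?r = "1 / real CARD('p)"
  have r: "0 < ?r" "?r < 1"
    using padic_int_gt_1[where 'p='p] by simp_all
  fix e :: real
  assume "0 < e"
  then obtain N where N: "?r ^ N < e"
    using real_arch_pow_inv[of e ?r] r by auto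
  have "dist (y k) l < e" if "N \<le> k" for k
  proof (cases "y k = l")
    case False
    then obtain v where v: "padic_val (y k - l) = enat v"
      by (auto simp: padic_val_def)
    then have "k \<le> v"
      using assms[of k] padic_val_ge_iff[of k "y k - l"] by simp
    then have "?r ^ v \<le> ?r ^ N"
      using r that by (intro power_decreasing) auto
    then show ?thesis
      using False v N by (simp add: dist_padic_int_def)
  qed (use \<open>0 < e\<close> in simp)
  then show "\<exists>N. \<forall>k\<ge>N. dist (y k) l < e"
    by blast
qed

section \<open>Maps that are close to the identity\<close>

text \<open>\<open>wdvd n m i j x\<close> means \<open>val x + (j - i)/n \<ge> m/n\<close>, with denominators cleared.\<close>

definition wdvd :: "nat \<Rightarrow> nat \<Rightarrow> nat \<Rightarrow> nat \<Rightarrow> 'p::prime_card padic_int \<Rightarrow> bool"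
  where "wdvd n m i j x \<longleftrightarrow> (\<exists>e. padic_prime ^ e dvd x \<and> m + i \<le> e * n + j)"

lemma wdvd_0: "0 < n \<Longrightarrow> wdvd n m i j 0"
  unfolding wdvd_def by (rule exI[of _ "m + i"]) (auto intro: trans_le_add1)

lemma wdvd_uminus: "wdvd n m i j (- x) \<longleftrightarrow> wdvd n m i j x"
  by (simp add: wdvd_def)

lemma wdvd_add:
  assumes "wdvd n m i j x" "wdvd n m i j y"
  shows "wdvd n m i j (x + y)"
proof -
  obtain e f where "padic_prime ^ e dvd x" "m + i \<le> e * n + j" "padic_prime ^ f dvd y" "m + i \<le> f * n + j"
    using assms by (auto simp: wdvd_def)
  moreover from this have "padic_prime ^ min e f dvd x + y"
    by (auto intro!: dvd_add elim!: dvd_trans[OF le_imp_power_dvd, rotated])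
  ultimately have "padic_prime ^ min e f dvd x + y" "m + i \<le> min e f * n + j"
    by (simp_all add: min_def)
  then show ?thesis
    unfolding wdvd_def by blast
qed

lemma wdvd_diff: "wdvd n m i j x \<Longrightarrow> wdvd n m i j y \<Longrightarrow> wdvd n m i j (x - y)"
  using wdvd_add[of n m i j x "- y"] by (simp add: wdvd_uminus)

lemma wdvd_diff_commute: "wdvd n m i j (x - y) \<longleftrightarrow> wdvd n m i j (y - x)"
  using wdvd_uminus[of n m i j "x - y"] by simp

lemma wdvd_trans: "wdvd n m i j (x - y) \<Longrightarrow> wdvd n m i j (y - z) \<Longrightarrow> wdvd n m i j (x - z)"
  using wdvd_add[of n m i j "x - y" "y - z"] by simp

lemma wdvd_sum: "0 < n \<Longrightarrow> (\<And>a. a \<in> S \<Longrightarrow> wdvd n m i j (f a)) \<Longrightarrow> wdvd n m i j (sum f S)"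
  by (induction S rule: infinite_finite_induct) (auto intro: wdvd_0 wdvd_add)

lemma wdvd_mult:
  assumes "wdvd n m i k x" "wdvd n l k j y"
  shows "wdvd n (m + l) i j (x * y)"
proof -
  obtain e f where "padic_prime ^ e dvd x" "m + i \<le> e * n + k" "padic_prime ^ f dvd y" "l + k \<le> f * n + j"
    using assms by (auto simp: wdvd_def)
  then have "padic_prime ^ (e + f) dvd x * y" "m + l + i \<le> (e + f) * n + j"
    by (auto simp: power_add algebra_simps intro: mult_dvd_mono)
  then show ?thesis
    unfolding wdvd_def by blast
qed

lemma wdvd_mono: "wdvd n m i j x \<Longrightarrow> l \<le> m \<Longrightarrow> wdvd n l i j x"
  unfolding wdvd_def by (meson add_le_mono1 le_trans)

lemma wdvd_multI: "wdvd n m i j x \<Longrightarrow> x dvd y \<Longrightarrow> wdvd n m i j y"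
  unfolding wdvd_def by (meson dvd_trans)

lemma wdvd_diag_shift: "wdvd n m i i x \<longleftrightarrow> wdvd n m j j x"
  by (simp add: wdvd_def)

lemma wdvd_diag_of_prime_dvd: "0 < n \<Longrightarrow> padic_prime dvd x \<Longrightarrow> wdvd n 1 i i x"
  unfolding wdvd_def by (rule exI[of _ 1]) simp

text \<open>Together with \<open>dvd_imp_wdvd\<close> this compares the filtration at a fixed
  position with the p-adic one, so both define the same topology and the intersection of all levels
  is zero.\<close>

lemma wdvd_imp_dvd:
  assumes "0 < n" "wdvd n (k * n + j) i j x"
  shows "padic_prime ^ k dvd x"
proof -
  obtain e where "padic_prime ^ e dvd x" "k * n + j + i \<le> e * n + j"
    using assms by (auto simp: wdvd_def)
  moreover have "k \<le> e"
    using calculation(2) assms(1) by (metis add.assoc add.commute add_le_cancel_right le_trans le_add1 mult_le_cancel2)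
  ultimately show ?thesis
    using dvd_trans[OF le_imp_power_dvd] by blast
qed

lemma dvd_imp_wdvd: "0 < n \<Longrightarrow> padic_prime ^ (m + i) dvd x \<Longrightarrow> wdvd n m i j x"
  unfolding wdvd_def by (rule exI[of _ "m + i"]) (auto intro: trans_le_add1)

lemma wdvd_imp_0: "0 < n \<Longrightarrow> (\<And>m. wdvd n m i j x) \<Longrightarrow> x = 0"
  by (rule padic_eq_0I) (rule wdvd_imp_dvd)

text \<open>For n = 1 the filtration is the p-adic one; this lets scalars be treated as 1 by 1
  matrices below.\<close>

lemma wdvd_1_0_0: "wdvd 1 m 0 0 x \<longleftrightarrow> padic_prime ^ m dvd x"
  using wdvd_imp_dvd[of 1 m 0 0 x] dvd_imp_wdvd[of 1 m 0 x 0] by auto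

lemma wdvd_chain:
  assumes "0 < n" "\<And>r. wdvd n (s + r) i j (x (Suc r) - x r)" "r \<le> r'"
  shows "wdvd n (s + r) i j (x r' - x r)"
  using assms(3)
proof (induction r' rule: dec_induct)
  case base
  then show ?case
    by (simp add: wdvd_0 assms(1))
next
  case (step r')
  from assms(2)[of r'] have "wdvd n (s + r) i j (x (Suc r') - x r')"
    by (rule wdvd_mono) (use step in simp)
  then show ?case
    using step.IH by (rule wdvd_trans)
qed

lemma wdvd_complete:
  fixes x :: "nat \<Rightarrow> 'p::prime_card padic_int"
  assumes n: "0 < n" and step: "\<And>r. wdvd n (s + r) i j (x (Suc r) - x r)"
  shows "\<exists>l. \<forall>r. wdvd n (s + r) i j (l - x r)"
proof -
  note chain = wdvd_chain[of n s i j x, OF n step]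
  \<comment> \<open>Along this subsequence consecutive terms agree modulo p^k in the plain sense, so
    \<open>padic_complete\<close> applies.\<close>
  define y where "y k = x (k * n + j)" for k
  have "padic_prime ^ k dvd y (Suc k) - y k" for k
  proof (rule wdvd_imp_dvd[OF n])
    show "wdvd n (k * n + j) i j (y (Suc k) - y k)"
      unfolding y_def by (rule wdvd_mono[OF chain]) simp_all
  qed
  then obtain l where l: "\<And>k. padic_prime ^ k dvd l - y k"
    by (rule padic_complete) blast
  have "wdvd n (s + r) i j (l - x r)" for r
  proof (rule wdvd_trans)
    \<comment> \<open>This index is large enough for both halves: p^(s+r+i) gives level s + r at row
      i, and k * n + j is at least r, so the telescoped estimate reaches it.\<close>
    let ?k = "s + r + i"
    show "wdvd n (s + r) i j (l - y ?k)"
      by (rule dvd_imp_wdvd[OF n]) (rule l)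
    have "r * 1 \<le> ?k * n"
      by (rule mult_le_mono) (use n in auto)
    then show "wdvd n (s + r) i j (y ?k - x r)"
      unfolding y_def by (intro chain) simp
  qed
  then show ?thesis
    by blast
qed

section \<open>Congruence modulo the filtration and near-identity maps\<close>

definition mcong :: "nat \<Rightarrow> nat \<Rightarrow> 'p::prime_card padic_int mat \<Rightarrow> 'p padic_int mat \<Rightarrow> bool"
  where "mcong n m A B \<longleftrightarrow> (\<forall>i<n. \<forall>j<n. wdvd n m i j (A $$ (i, j) - B $$ (i, j)))"

lemma mcong_refl: "0 < n \<Longrightarrow> mcong n m A A"
  by (simp add: mcong_def wdvd_0)

lemma mcong_sym: "mcong n m A B \<Longrightarrow> mcong n m B A"
  by (simp add: mcong_def wdvd_diff_commute)

lemma mcong_trans: "mcong n m A B \<Longrightarrow> mcong n m B C \<Longrightarrow> mcong n m A C"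
  unfolding mcong_def by (blast intro: wdvd_trans)

lemma mcong_mono: "mcong n m A B \<Longrightarrow> l \<le> m \<Longrightarrow> mcong n l A B"
  unfolding mcong_def by (blast intro: wdvd_mono)

lemma mcong_imp_eq:
  assumes "0 < n" "A \<in> carrier_mat n n" "B \<in> carrier_mat n n" "\<And>m. mcong n m A B"
  shows "A = B"
proof (rule eq_matI)
  fix i j assume "i < dim_row B" "j < dim_col B"
  then have "A $$ (i, j) - B $$ (i, j) = 0"
    using assms by (intro wdvd_imp_0[of n i j]) (auto simp: mcong_def)
  then show "A $$ (i, j) = B $$ (i, j)"
    by simp
qed (use assms in auto)

text \<open>The domain is the set of matrices congruent to 0 at level s. The locale is used with s =
  1 for the ordered product and with s = 0, n = 1 for functions on the p-adic integers, where the
  domain is everything.\<close>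

locale near_identity =
  fixes n s :: nat and F :: "'p::prime_card padic_int mat \<Rightarrow> 'p padic_int mat"
  assumes n: "0 < n"
    and F_carrier: "\<And>C. C \<in> carrier_mat n n \<Longrightarrow> F C \<in> carrier_mat n n"
    and near: "\<And>m C D i j. \<lbrakk>C \<in> carrier_mat n n; D \<in> carrier_mat n n; s \<le> m;
      mcong n s C (0\<^sub>m n n); mcong n s D (0\<^sub>m n n); mcong n m C D; i < n; j < n\<rbrakk> \<Longrightarrow>
      wdvd n (Suc m) i j (F C $$ (i, j) - F D $$ (i, j) - (C $$ (i, j) - D $$ (i, j)))"
begin

text \<open>An error one level deeper than the difference cannot affect its leading part. For the
  implication from the images to the arguments, the level known for C - D is raised one step at a
  time.\<close>

lemma mcong_F_iff:
  assumes C: "C \<in> carrier_mat n n" "mcong n s C (0\<^sub>m n n)"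
    and D: "D \<in> carrier_mat n n" "mcong n s D (0\<^sub>m n n)" and "s \<le> m"
  shows "mcong n m (F C) (F D) \<longleftrightarrow> mcong n m C D"
proof
  assume "mcong n m (F C) (F D)"
  \<comment> \<open>Restated so that the hypothesis on the images takes part in the induction on
    m.\<close>
  moreover have "mcong n m C D" if "mcong n m (F C) (F D)"
    using \<open>s \<le> m\<close> that
  proof (induction m rule: dec_induct)
    case base
    show ?case
      using C(2) mcong_sym[OF D(2)] by (rule mcong_trans)
  next
    case (step m)
    have CD: "mcong n m C D"
      using step.IH mcong_mono[OF step.prems] by simp
    show ?case
      unfolding mcong_def
    proof (intro allI impI)
      fix i j assume ij: "i < n" "j < n"
      then show "wdvd n (Suc m) i j (C $$ (i, j) - D $$ (i, j))"
        using wdvd_diff[OF _ near[OF C(1) D(1) step.hyps(1) C(2) D(2) CD ij], of "F C $$ (i, j) - F D $$ (i, j)"]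
          step.prems by (simp add: mcong_def)
    qed
  qed
  ultimately show "mcong n m C D"
    by simp
next
  assume CD: "mcong n m C D"
  show "mcong n m (F C) (F D)"
    unfolding mcong_def
  proof (intro allI impI)
    fix i j assume ij: "i < n" "j < n"
    then show "wdvd n m i j (F C $$ (i, j) - F D $$ (i, j))"
      using wdvd_add[OF wdvd_mono[OF near[OF C(1) D(1) \<open>s \<le> m\<close> C(2) D(2) CD ij]], of m "C $$ (i, j) - D $$ (i, j)"] CD
      by (simp add: mcong_def)
  qed
qed

lemma F_surj:
  assumes A: "A \<in> carrier_mat n n" "mcong n s A (F (0\<^sub>m n n))"
  obtains C where "C \<in> carrier_mat n n" "mcong n s C (0\<^sub>m n n)" "F C = A"
proof -
  define T where "T C = mat n n (\<lambda>ij. C $$ ij - F C $$ ij + A $$ ij)" for C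
  define c where "c r = (T ^^ r) (0\<^sub>m n n)" for r
  have c_Suc: "c (Suc r) = T (c r)" for r
    by (simp add: c_def)
  have T_carrier: "T C \<in> carrier_mat n n" for C
    by (simp add: T_def)
  have T_dom: "mcong n s (T C) (0\<^sub>m n n)" if C: "C \<in> carrier_mat n n" "mcong n s C (0\<^sub>m n n)" for C
    unfolding mcong_def
  proof (intro allI impI)
    fix i j assume ij: "i < n" "j < n"
    have "wdvd n s i j (F C $$ (i, j) - F (0\<^sub>m n n) $$ (i, j) - (C $$ (i, j) - 0\<^sub>m n n $$ (i, j)))"
      by (rule wdvd_mono[OF near[of _ _ s]]) (use C ij n in \<open>auto intro: mcong_refl\<close>)
    moreover have "wdvd n s i j (A $$ (i, j) - F (0\<^sub>m n n) $$ (i, j))"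
      using A ij by (simp add: mcong_def)
    \<comment> \<open>After the F 0 terms cancel, this combination is the entry of T C.\<close>
    ultimately have "wdvd n s i j (A $$ (i, j) - F (0\<^sub>m n n) $$ (i, j) - (F C $$ (i, j) - F (0\<^sub>m n n) $$ (i, j) - (C $$ (i, j) - 0\<^sub>m n n $$ (i, j))))"
      by - (rule wdvd_diff)
    then show "wdvd n s i j (T C $$ (i, j) - 0\<^sub>m n n $$ (i, j))"
      using ij by (simp add: T_def algebra_simps)
  qed
  have c: "c r \<in> carrier_mat n n" "mcong n s (c r) (0\<^sub>m n n)" for r
  proof (induction r)
    case 0
    show "c 0 \<in> carrier_mat n n" "mcong n s (c 0) (0\<^sub>m n n)"
      by (simp_all add: c_def mcong_refl n)
  next
    case (Suc r)
    then show "c (Suc r) \<in> carrier_mat n n" "mcong n s (c (Suc r)) (0\<^sub>m n n)"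
      by (simp_all add: c_Suc T_carrier T_dom)
  qed
  have T_contr: "wdvd n (Suc m) i j (T C $$ (i, j) - T D $$ (i, j))"
    if "C \<in> carrier_mat n n" "mcong n s C (0\<^sub>m n n)" "D \<in> carrier_mat n n" "mcong n s D (0\<^sub>m n n)"
      "s \<le> m" "mcong n m C D" "i < n" "j < n" for C D m i j
    \<comment> \<open>The arguments are swapped because T C - T D equals (F D - F C) - (D - C),
      which is the error term itself.\<close>
    using near[of D C m i j] that mcong_sym[of n m C D] by (simp add: T_def algebra_simps)
  have c_step: "mcong n (s + r) (c (Suc r)) (c r)" for r
  proof (induction r)
    case 0
    show ?case
      using mcong_trans[OF c(2) mcong_sym[OF c(2)]] by simp
  next
    case (Suc r)
    then show ?case
      using T_contr[OF c c, of "s + r" "Suc r" r] by (simp add: mcong_def c_Suc)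
  qed
  have "\<exists>l. \<forall>r. wdvd n (s + r) i j (l - c r $$ (i, j))" if "i < n" "j < n" for i j
    using wdvd_complete[OF n, of s i j "\<lambda>r. c r $$ (i, j)"] c_step that by (auto simp: mcong_def)
  then obtain l where l: "\<And>i j r. i < n \<Longrightarrow> j < n \<Longrightarrow> wdvd n (s + r) i j (l i j - c r $$ (i, j))"
    by metis
  define C where "C = mat n n (\<lambda>(i, j). l i j)"
  have C: "C \<in> carrier_mat n n"
    by (simp add: C_def)
  have Cc: "mcong n (s + r) C (c r)" for r
    using l by (simp add: mcong_def C_def)
  have C0: "mcong n s C (0\<^sub>m n n)"
    using Cc[of 0] c(2)[of 0] by (auto intro: mcong_trans)
  \<comment> \<open>Since F C - A = C - T C, it suffices that the limit is fixed by T at every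
    level; T C is close to T (c r) = c (r + 1), which is close to C.\<close>
  have "mcong n (s + r) (F C) A" for r
    unfolding mcong_def
  proof (intro allI impI)
    fix i j assume ij: "i < n" "j < n"
    have "wdvd n (s + r) i j (T C $$ (i, j) - T (c r) $$ (i, j))"
      by (rule wdvd_mono[OF T_contr[OF C C0 c _ Cc ij]]) simp_all
    then have "wdvd n (s + r) i j (T C $$ (i, j) - c (Suc r) $$ (i, j))"
      by (simp add: c_Suc)
    moreover have "wdvd n (s + r) i j (c (Suc r) $$ (i, j) - C $$ (i, j))"
      using mcong_mono[OF mcong_sym[OF Cc[of "Suc r"]], of "s + r"] ij by (simp add: mcong_def)
    ultimately have "wdvd n (s + r) i j (T C $$ (i, j) - C $$ (i, j))"
      by (rule wdvd_trans)
    then show "wdvd n (s + r) i j (F C $$ (i, j) - A $$ (i, j))"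
      using ij wdvd_diff_commute by (fastforce simp: T_def)
  qed
  then have "mcong n m (F C) A" for m
    using mcong_mono[of n "s + m" "F C" A m] by simp
  then have "F C = A"
    by (rule mcong_imp_eq[OF n F_carrier[OF C] A(1)])
  with C C0 show ?thesis
    by (rule that)
qed

end

section \<open>Units and powers of \<open>1 + p\<close>\<close>

lemma near_identity_1_surj:
  fixes f :: "'p::prime_card padic_int \<Rightarrow> 'p padic_int"
  assumes near: "\<And>k x y. padic_prime ^ k dvd x - y \<Longrightarrow> padic_prime ^ Suc k dvd f x - f y - (x - y)"
  shows "\<exists>x. f x = y"
proof -
  interpret near_identity 1 0 "\<lambda>C. mat 1 1 (\<lambda>ij. f (C $$ ij))"
  proof (unfold_locales, goal_cases)
    case (3 m C D i j)
    then show ?case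
      using near[of m "C $$ (0, 0)" "D $$ (0, 0)"] wdvd_1_0_0[of m "C $$ (0, 0) - D $$ (0, 0)"]
        wdvd_1_0_0[of "Suc m" "f (C $$ (0, 0)) - f (D $$ (0, 0)) - (C $$ (0, 0) - D $$ (0, 0))"]
      by (simp add: mcong_def)
  qed simp_all
  have "mcong 1 0 (mat 1 1 (\<lambda>_. y)) (mat 1 1 (\<lambda>ij. f (0\<^sub>m 1 1 $$ ij)))"
    using wdvd_1_0_0[of 0 "y - f 0"] by (simp add: mcong_def)
  then obtain C where "mat 1 1 (\<lambda>ij. f (C $$ ij)) = mat 1 1 (\<lambda>_. y)"
    using F_surj[of "mat 1 1 (\<lambda>_. y)"] by auto
  then have "mat 1 1 (\<lambda>ij. f (C $$ ij)) $$ (0, 0) = mat 1 1 (\<lambda>_. y) $$ (0, 0)"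
    by simp
  then show ?thesis
    by auto
qed

lemma unit_inv_eqI: "u * v = 1 \<Longrightarrow> unit_inv u = v"
  unfolding unit_inv_def
proof (rule the_equality)
  fix w assume "u * v = 1" "u * w = 1"
  then have "w = (u * v) * w" "v = (u * w) * v"
    by simp_all
  then show "w = v"
    by (metis mult.assoc mult.commute)
qed

lemma unit_inv_1: "unit_inv 1 = 1"
  by (rule unit_inv_eqI) simp

text \<open>Multiplication by u differs from the identity by multiplication by u - 1, which gains a
  factor p. It is therefore a near-identity map, hence surjective, and attains the value 1.\<close>

lemma padic_unit_inv:
  fixes u :: "'p::prime_card padic_int"
  assumes "padic_prime dvd u - 1"
  shows "u * unit_inv u = 1"
proof -
  have "padic_prime ^ Suc k dvd u * x - u * y - (x - y)" if "padic_prime ^ k dvd x - y" for k x y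
    using mult_dvd_mono[OF assms that] by (simp add: algebra_simps)
  then obtain v where "u * v = 1"
    using near_identity_1_surj[of "\<lambda>x. u * x" 1] by blast
  then show ?thesis
    using unit_inv_eqI by blast
qed

lemma unit_inv_diff:
  fixes u v :: "'p::prime_card padic_int"
  assumes "padic_prime dvd u - 1" "padic_prime dvd v - 1"
  shows "unit_inv u - unit_inv v = (v - u) * (unit_inv u * unit_inv v)"
proof -
  have "(v - u) * (unit_inv u * unit_inv v) = unit_inv u * (v * unit_inv v) - unit_inv v * (u * unit_inv u)"
    by (simp add: algebra_simps)
  then show ?thesis
    by (simp add: padic_unit_inv assms)
qed

lemma prime_dvd_unit_inv:
  fixes u :: "'p::prime_card padic_int"
  assumes "padic_prime dvd u - 1"
  shows "padic_prime dvd unit_inv u - 1"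
  using unit_inv_diff[OF assms, of 1] assms
  by (simp add: unit_inv_1 dvd_diff_swap[of _ 1])

lemma dvd_mult_minus_1:
  fixes a b :: "'a::comm_ring_1"
  assumes "c dvd a - 1" "c dvd b - 1"
  shows "c dvd a * b - 1"
proof -
  have "a * b - 1 = (a - 1) * b + (b - 1)"
    by (simp add: algebra_simps)
  with assms show ?thesis
    by (metis dvd_add dvd_mult2)
qed

lemma dvd_power_minus_1:
  fixes a :: "'a::comm_ring_1"
  shows "c dvd a - 1 \<Longrightarrow> c dvd a ^ k - 1"
  by (induction k) (auto intro: dvd_mult_minus_1)

lemma square_dvd_power_minus_linear:
  fixes t :: "'a::comm_ring_1"
  shows "t ^ 2 dvd (1 + t) ^ k - 1 - of_nat k * t"
proof (induction k)
  case (Suc k)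
  have "(1 + t) ^ Suc k - 1 - of_nat (Suc k) * t
    = (1 + t) * ((1 + t) ^ k - 1 - of_nat k * t) + t ^ 2 * of_nat k"
    by (simp add: algebra_simps power2_eq_square)
  then show ?case
    using Suc by (metis dvd_add dvd_mult dvd_triv_left)
qed simp

text \<open>Factor y^p - 1 as (y - 1) times the sum of the powers y^i with i < p. That sum is p
  modulo p^2, so the p-th power multiplies the leading term of y - 1 by p.\<close>

lemma power_prime_near:
  fixes y :: "'p::prime_card padic_int"
  assumes p: "CARD('p) > 2" and y: "padic_prime ^ (k + 2) dvd y - 1 - padic_prime ^ (k + 1)"
  shows "padic_prime ^ (k + 3) dvd y ^ CARD('p) - 1 - padic_prime ^ (k + 2)"
proof -
  let ?p = "padic_prime :: 'p padic_int"
  from y obtain s where s: "y - 1 - ?p ^ (k + 1) = ?p ^ (k + 2) * s" ..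
  define t where "t = y - 1"
  have t: "t = ?p ^ (k + 1) * (1 + ?p * s)"
    using s by (simp add: t_def algebra_simps)
  have y_eq: "y = 1 + t"
    by (simp add: t_def)
  have tp: "?p dvd t"
    by (simp add: t)
  then have tp2: "?p ^ 2 dvd t ^ 2"
    by (rule dvd_power_same)
  \<comment> \<open>Here p > 2 enters: for p = 2h + 1 the sum 0 + ... + (p - 1) is p * h, so the
    terms linear in t vanish modulo p^2.\<close>
  have "odd CARD('p)"
    using prime_card[where 'a='p] p prime_odd_nat by blast
  then obtain h where h: "CARD('p) = Suc (2 * h)"
    by (auto elim: oddE)
  have "\<Sum>{..<CARD('p)} = CARD('p) * h"
    unfolding h lessThan_Suc_atMost atMost_atLeast0 gauss_sum_nat by simp
  then have sum_id: "(\<Sum>i<CARD('p). of_nat i) = ?p * of_nat h"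
    by (simp add: padic_prime_def flip: of_nat_sum)
  have "?p ^ 2 dvd (\<Sum>i<CARD('p). y ^ i - 1 - of_nat i * t)"
    by (rule dvd_sum) (use tp2 square_dvd_power_minus_linear dvd_trans y_eq in blast)
  also have "(\<Sum>i<CARD('p). y ^ i - 1 - of_nat i * t) = (\<Sum>i<CARD('p). y ^ i) - ?p - ?p * t * of_nat h"
    by (simp add: sum_subtractf sum_id padic_prime_def flip: sum_distrib_right)
  finally have "?p ^ 2 dvd (\<Sum>i<CARD('p). y ^ i) - ?p - ?p * t * of_nat h" .
  moreover have "?p ^ 2 dvd ?p * t * of_nat h"
    using tp by (simp add: power2_eq_square mult_dvd_mono)
  ultimately have "?p ^ 2 dvd ((\<Sum>i<CARD('p). y ^ i) - ?p - ?p * t * of_nat h) + ?p * t * of_nat h"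
    by (rule dvd_add)
  then obtain r where r: "(\<Sum>i<CARD('p). y ^ i) - ?p = ?p ^ 2 * r"
    by auto
  have "y ^ CARD('p) - 1 = t * (\<Sum>i<CARD('p). y ^ i)"
    by (simp add: power_diff_1_eq t_def)
  also have "\<dots> = t * (?p + ?p ^ 2 * r)"
    using r by (simp add: algebra_simps)
  also have "\<dots> = ?p ^ (k + 2) + ?p ^ (k + 3) * (s + r + ?p * s * r)"
    by (simp add: t algebra_simps power2_eq_square numeral_3_eq_3)
  finally show ?thesis
    by simp
qed

lemma one_plus_prime_power_prime_power:
  assumes p: "CARD('p::prime_card) > 2"
  shows "(padic_prime :: 'p padic_int) ^ (k + 2) dvd (1 + padic_prime) ^ CARD('p) ^ k - 1 - padic_prime ^ (k + 1)"
proof (induction k)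
  case (Suc k)
  have "(1 + padic_prime :: 'p padic_int) ^ CARD('p) ^ Suc k = ((1 + padic_prime) ^ CARD('p) ^ k) ^ CARD('p)"
    by (simp add: power_mult[symmetric] mult.commute)
  then show ?case
    using power_prime_near[OF p Suc] by (simp add: numeral_3_eq_3)
qed simp

text \<open>Put t = (1 + p)^(p^k) - 1, which is p^(k+1) to leading order. Expanding (1 + t)^c to
  first order gives 1 + c * p^(k+1), because t^2 is already divisible by p^(2k+2); the factor (1 +
  p)^M is 1 modulo p.\<close>

lemma one_plus_prime_power_near_le:
  assumes p: "CARD('p::prime_card) > 2" and N: "N = M + CARD('p) ^ k * c"
  shows "(padic_prime :: 'p padic_int) ^ (k + 2) dvd
    (1 + padic_prime) ^ N - (1 + padic_prime) ^ M - padic_prime * (of_nat N - of_nat M)"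
proof -
  let ?p = "padic_prime :: 'p padic_int"
  define t where "t = (1 + ?p) ^ CARD('p) ^ k - 1"
  from one_plus_prime_power_prime_power[OF p, of k]
  obtain s where s: "t - ?p ^ (k + 1) = ?p ^ (k + 2) * s"
    unfolding t_def ..
  have t: "t = ?p ^ (k + 1) * (1 + ?p * s)"
    using s by (simp add: algebra_simps)
  obtain r where "(1 + t) ^ c - 1 - of_nat c * t = t ^ 2 * r"
    using square_dvd_power_minus_linear[of t c] ..
  then have r: "(1 + ?p) ^ (CARD('p) ^ k * c) = 1 + of_nat c * t + t ^ 2 * r"
    unfolding power_mult by (simp add: t_def algebra_simps)
  obtain w where "(1 + ?p) ^ M - 1 = ?p * w"
    using dvd_power_minus_1[of ?p "1 + ?p" M] by auto
  then have w: "(1 + ?p) ^ M = 1 + ?p * w"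
    by (simp add: algebra_simps)
  have "(1 + ?p) ^ N - (1 + ?p) ^ M - ?p * (of_nat N - of_nat M)
    = (1 + ?p * w) * (of_nat c * t + t ^ 2 * r) - ?p ^ (k + 1) * of_nat c"
    unfolding N power_add r w by (simp add: algebra_simps padic_prime_def)
  also have "\<dots> = ?p ^ (k + 2) * (of_nat c * s + w * of_nat c * (1 + ?p * s) + (1 + ?p * w) * (?p ^ k * (1 + ?p * s) ^ 2 * r))"
    unfolding t by (simp add: algebra_simps power2_eq_square)
  finally show ?thesis
    by simp
qed

lemma one_plus_prime_power_near:
  assumes p: "CARD('p::prime_card) > 2"
    and NM: "(padic_prime :: 'p padic_int) ^ k dvd of_nat N - of_nat M"
  shows "(padic_prime :: 'p padic_int) ^ (k + 2) dvd
    (1 + padic_prime) ^ N - (1 + padic_prime) ^ M - padic_prime * (of_nat N - of_nat M)"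
proof -
  have "int N mod int CARD('p) ^ k = int M mod int CARD('p) ^ k"
    using NM by (simp add: padic_prime_power_dvd_diff_iff padic_res_of_nat)
  then have NM': "N mod CARD('p) ^ k = M mod CARD('p) ^ k"
    by (simp flip: of_nat_power of_nat_mod)
  have *: "\<exists>c. N = M + CARD('p) ^ k * c" if "N mod CARD('p) ^ k = M mod CARD('p) ^ k" "M \<le> N" for N M :: nat
    using that by (metis mod_eq_dvd_iff_nat dvdE le_add_diff_inverse)
  show ?thesis
  proof (cases "M \<le> N")
    case True
    then show ?thesis
      using one_plus_prime_power_near_le[OF p] *[OF NM'] by blast
  next
    case False
    then have "(padic_prime :: 'p padic_int) ^ (k + 2) dvd
        - ((1 + padic_prime) ^ M - (1 + padic_prime) ^ N - padic_prime * (of_nat M - of_nat N))"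
      using one_plus_prime_power_near_le[OF p] *[OF NM'[symmetric]] by (subst dvd_minus_iff) fastforce
    then show ?thesis
      by (simp add: algebra_simps)
  qed
qed

text \<open>The p-adic power (1 + p)^z as a scalar. It is the diagonal entry that
  \<open>padic_pow\<close> produces from a torus generator.\<close>

definition one_plus_prime_pow :: "'p::prime_card padic_int \<Rightarrow> 'p padic_int"
  where "one_plus_prime_pow z = lim (\<lambda>k. (1 + padic_prime) ^ nat (padic_res z k))"

context
  assumes p: "CARD('p::prime_card) > 2"
begin

text \<open>Consecutive truncations of the exponent agree modulo p^k, so by
  \<open>one_plus_prime_power_near\<close> the powers agree modulo p^(k+1). This gives both the
  existence of the limit and the rate of convergence.\<close>

lemma one_plus_prime_pow_approx:
  "padic_prime ^ Suc k dvd one_plus_prime_pow z - (1 + padic_prime :: 'p padic_int) ^ nat (padic_res z k)"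
proof -
  let ?p = "padic_prime :: 'p padic_int"
  let ?N = "\<lambda>k. nat (padic_res z k)"
  have "?p ^ Suc k dvd (1 + ?p) ^ ?N (Suc k) - (1 + ?p) ^ ?N k" for k
  proof -
    have "?p ^ k dvd z - of_nat (?N (Suc k))"
      using padic_prime_power_dvd_res[of "Suc k" z] by (rule dvd_trans[rotated]) simp
    with padic_prime_power_dvd_res[of k z]
    have "?p ^ k dvd (z - of_nat (?N k)) - (z - of_nat (?N (Suc k)))"
      by (rule dvd_diff)
    then have 1: "?p ^ k dvd of_nat (?N (Suc k)) - of_nat (?N k)"
      by simp
    have "?p ^ Suc k dvd (1 + ?p) ^ ?N (Suc k) - (1 + ?p) ^ ?N k - ?p * (of_nat (?N (Suc k)) - of_nat (?N k))"
      by (rule dvd_trans[OF _ one_plus_prime_power_near[OF p 1]]) simp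
    moreover have "?p ^ Suc k dvd ?p * (of_nat (?N (Suc k)) - of_nat (?N k))"
      using 1 by (simp add: mult_dvd_mono)
    ultimately have "?p ^ Suc k dvd ((1 + ?p) ^ ?N (Suc k) - (1 + ?p) ^ ?N k - ?p * (of_nat (?N (Suc k)) - of_nat (?N k))) + ?p * (of_nat (?N (Suc k)) - of_nat (?N k))"
      by (rule dvd_add)
    then show ?thesis
      by simp
  qed note step = this
  \<comment> \<open>The index is shifted by one so that congruences modulo p^(k+1) take the form
    required by \<open>padic_complete\<close>.\<close>
  define x where "x k = (1 + ?p) ^ ?N (k - 1)" for k
  have "?p ^ k dvd x (Suc k) - x k" for k
    using step[of "k - 1"] by (cases k) (simp_all add: x_def)
  then obtain l where l: "\<And>k. ?p ^ k dvd l - x k"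
    by (rule padic_complete) blast
  have l': "?p ^ Suc k dvd l - (1 + ?p) ^ ?N k" for k
    using l[of "Suc k"] by (simp add: x_def)
  have "?p ^ k dvd (1 + ?p) ^ ?N k - l" for k
    by (subst dvd_diff_swap, rule dvd_trans[OF _ l']) simp
  then have "(\<lambda>k. (1 + ?p) ^ ?N k) \<longlonglongrightarrow> l"
    by (rule padic_tendstoI)
  then have "one_plus_prime_pow z = l"
    unfolding one_plus_prime_pow_def by (rule limI)
  then show ?thesis
    using l' by simp
qed

lemma one_plus_prime_pow_near:
  fixes z w :: "'p padic_int"
  assumes zw: "padic_prime ^ k dvd z - w"
  shows "padic_prime ^ (k + 2) dvd one_plus_prime_pow z - one_plus_prime_pow w - padic_prime * (z - w)"
proof -
  let ?p = "padic_prime :: 'p padic_int"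
  \<comment> \<open>Truncation at level k + 1 makes both approximation errors divisible by p^(k+2),
    the precision of the claim.\<close>
  let ?N = "nat (padic_res z (Suc k))" and ?M = "nat (padic_res w (Suc k))"
  have z: "?p ^ Suc k dvd z - of_nat ?N" and w: "?p ^ Suc k dvd w - of_nat ?M"
    by (rule padic_prime_power_dvd_res)+
  then have "?p ^ k dvd z - of_nat ?N" "?p ^ k dvd w - of_nat ?M"
    by (auto intro: dvd_trans[rotated])
  then have "?p ^ k dvd (z - w) - ((z - of_nat ?N) - (w - of_nat ?M))"
    by (intro dvd_diff[OF zw dvd_diff])
  then have "?p ^ k dvd of_nat ?N - of_nat ?M"
    by (simp add: algebra_simps)
  then have 1: "?p ^ (k + 2) dvd (1 + ?p) ^ ?N - (1 + ?p) ^ ?M - ?p * (of_nat ?N - of_nat ?M)"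
    by (rule one_plus_prime_power_near[OF p])
  have 2: "?p ^ (k + 2) dvd ?p * ((z - of_nat ?N) - (w - of_nat ?M))"
    using mult_dvd_mono[OF dvd_refl[of ?p] dvd_diff[OF z w]] by simp
  have 3: "?p ^ (k + 2) dvd one_plus_prime_pow z - (1 + ?p) ^ ?N" "?p ^ (k + 2) dvd one_plus_prime_pow w - (1 + ?p) ^ ?M"
    using one_plus_prime_pow_approx[of "Suc k"] by simp_all
  have eq: "one_plus_prime_pow z - one_plus_prime_pow w - ?p * (z - w)
    = ((1 + ?p) ^ ?N - (1 + ?p) ^ ?M - ?p * (of_nat ?N - of_nat ?M)) - ?p * ((z - of_nat ?N) - (w - of_nat ?M))
      + (one_plus_prime_pow z - (1 + ?p) ^ ?N) - (one_plus_prime_pow w - (1 + ?p) ^ ?M)"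
    by (simp add: algebra_simps)
  show ?thesis
    unfolding eq by (rule dvd_diff[OF dvd_add[OF dvd_diff[OF 1 2] 3(1)] 3(2)])
qed

lemma one_plus_prime_pow_0: "one_plus_prime_pow (0 :: 'p padic_int) = 1"
  unfolding one_plus_prime_pow_def by (simp add: zero_padic_int.rep_eq)

lemma prime_dvd_one_plus_prime_pow: "padic_prime dvd one_plus_prime_pow (z :: 'p padic_int) - 1"
proof -
  have "padic_prime dvd one_plus_prime_pow z - (1 + padic_prime) ^ nat (padic_res z 0)"
    using one_plus_prime_pow_approx[of 0 z] by simp
  moreover have "padic_prime dvd (1 + padic_prime :: 'p padic_int) ^ nat (padic_res z 0) - 1"
    by (rule dvd_power_minus_1) simp
  ultimately show ?thesis
    using dvd_add by fastforce
qed

text \<open>The difference of the powers and p * (z - w) agree to leading order. The induction gains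
  one power of p per step: a bound on z - w makes the error small enough to improve that
  bound.\<close>

lemma one_plus_prime_pow_dvd_iff:
  fixes z w :: "'p padic_int"
  shows "padic_prime ^ k dvd one_plus_prime_pow z - one_plus_prime_pow w \<longleftrightarrow> padic_prime ^ k dvd padic_prime * (z - w)"
proof (cases k)
  case (Suc l)
  let ?p = "padic_prime :: 'p padic_int" and ?d = "one_plus_prime_pow z - one_plus_prime_pow w"
  have "?p ^ l dvd z - w" if "?p ^ Suc l dvd ?d" for l
    using that
  proof (induction l)
    case (Suc l)
    have "?p ^ l dvd z - w"
      by (rule Suc.IH) (use Suc.prems in \<open>auto intro: dvd_trans[rotated]\<close>)
    then have "?p ^ Suc (Suc l) dvd ?d - ?p * (z - w)"
      using one_plus_prime_pow_near[of l z w] by simp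
    from dvd_diff[OF Suc.prems this] show ?case
      using padic_prime_mult_dvd_iff[of "Suc l" "z - w"] by simp
  qed simp
  moreover have "?p ^ Suc l dvd ?d" if "?p ^ Suc l dvd ?p * (z - w)"
  proof -
    have "?p ^ l dvd z - w"
      using that padic_prime_mult_dvd_iff by blast
    then have "?p ^ Suc l dvd ?d - ?p * (z - w)"
      using one_plus_prime_pow_near[of l z w] by (auto intro: dvd_trans[rotated])
    from dvd_add[OF this that] show ?thesis
      by simp
  qed
  ultimately show ?thesis
    using Suc padic_prime_mult_dvd_iff by blast
qed simp

text \<open>The quotient ((1 + p)^z - 1) / p is a near-identity map of z, hence surjective.\<close>

lemma one_plus_prime_pow_surj:
  fixes u :: "'p padic_int"
  assumes "padic_prime dvd u - 1"
  shows "\<exists>z. one_plus_prime_pow z = u"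
proof -
  let ?p = "padic_prime :: 'p padic_int"
  obtain y where y: "u - 1 = ?p * y"
    using assms ..
  have "\<exists>q. one_plus_prime_pow z - 1 = ?p * q" for z
    using prime_dvd_one_plus_prime_pow[of z] by (auto elim: dvdE)
  then obtain q where q: "\<And>z. one_plus_prime_pow z - 1 = ?p * q z"
    by metis
  have "?p ^ Suc k dvd q z - q w - (z - w)" if "?p ^ k dvd z - w" for k z w
  proof -
    have "?p ^ Suc (Suc k) dvd (one_plus_prime_pow z - 1) - (one_plus_prime_pow w - 1) - ?p * (z - w)"
      using one_plus_prime_pow_near[OF that] by simp
    then have "?p ^ Suc (Suc k) dvd ?p * (q z - q w - (z - w))"
      unfolding q by (simp add: algebra_simps)
    then show ?thesis
      using padic_prime_mult_dvd_iff by blast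
  qed
  then obtain z where "q z = y"
    using near_identity_1_surj[of q y] by blast
  with q[of z] y have "one_plus_prime_pow z - 1 = u - 1"
    by simp
  then show ?thesis
    by auto
qed

end

section \<open>Ordered products of elementary factors\<close>

text \<open>The expression is the entry of (A - A')(B - 1) + (A' - 1)(B - B'). Each product has one
  factor at level m and one at level 1, so it lies at level m + 1.\<close>

lemma mult_near:
  assumes n: "0 < n"
    and [simp]: "A \<in> carrier_mat n n" "B \<in> carrier_mat n n" "A' \<in> carrier_mat n n" "B' \<in> carrier_mat n n"
    and A': "mcong n 1 A' (1\<^sub>m n)" and B: "mcong n 1 B (1\<^sub>m n)"
    and AA': "mcong n m A A'" and BB': "mcong n m B B'" and [simp]: "i < n" "j < n"
  shows "wdvd n (Suc m) i j ((A * B) $$ (i, j) - (A' * B') $$ (i, j)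
    - (A $$ (i, j) - A' $$ (i, j)) - (B $$ (i, j) - B' $$ (i, j)))"
proof -
  let ?I = "1\<^sub>m n :: 'a padic_int mat"
  have mult: "(X * Y) $$ (i, j) = (\<Sum>k<n. X $$ (i, k) * Y $$ (k, j))"
    if "X \<in> carrier_mat n n" "Y \<in> carrier_mat n n" for X Y :: "'a padic_int mat"
    using that by (simp add: scalar_prod_def lessThan_atLeast0)
  have I: "(\<Sum>k<n. X $$ (i, k) * ?I $$ (k, j)) = X $$ (i, j)" "(\<Sum>k<n. ?I $$ (i, k) * X $$ (k, j)) = X $$ (i, j)"
    for X :: "'a padic_int mat"
    by (simp_all add: if_distrib[of "\<lambda>x. _ * x"] if_distrib[of "\<lambda>x. x * _"] sum.delta cong: if_cong)
  have "wdvd n (m + 1) i j (\<Sum>k<n. (A $$ (i, k) - A' $$ (i, k)) * (B $$ (k, j) - ?I $$ (k, j)))"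
  proof (rule wdvd_sum[OF n])
    fix k assume "k \<in> {..<n}"
    then show "wdvd n (m + 1) i j ((A $$ (i, k) - A' $$ (i, k)) * (B $$ (k, j) - ?I $$ (k, j)))"
      using AA' B by (intro wdvd_mult[of _ _ _ k]) (simp_all add: mcong_def del: One_nat_def index_one_mat)
  qed
  moreover have "wdvd n (1 + m) i j (\<Sum>k<n. (A' $$ (i, k) - ?I $$ (i, k)) * (B $$ (k, j) - B' $$ (k, j)))"
  proof (rule wdvd_sum[OF n])
    fix k assume "k \<in> {..<n}"
    then show "wdvd n (1 + m) i j ((A' $$ (i, k) - ?I $$ (i, k)) * (B $$ (k, j) - B' $$ (k, j)))"
      using A' BB' by (intro wdvd_mult[of _ _ _ k]) (simp_all add: mcong_def del: One_nat_def index_one_mat)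
  qed
  ultimately have "wdvd n (Suc m) i j
     ((\<Sum>k<n. (A $$ (i, k) - A' $$ (i, k)) * (B $$ (k, j) - ?I $$ (k, j)))
      + (\<Sum>k<n. (A' $$ (i, k) - ?I $$ (i, k)) * (B $$ (k, j) - B' $$ (k, j))))"
    by (simp add: wdvd_add)
  also have "(\<Sum>k<n. (A $$ (i, k) - A' $$ (i, k)) * (B $$ (k, j) - ?I $$ (k, j)))
      + (\<Sum>k<n. (A' $$ (i, k) - ?I $$ (i, k)) * (B $$ (k, j) - B' $$ (k, j)))
    = (A * B) $$ (i, j) - (A' * B') $$ (i, j)
    - (A $$ (i, j) - A' $$ (i, j)) - (B $$ (i, j) - B' $$ (i, j))"
    by (simp add: mult left_diff_distrib right_diff_distrib sum_subtractf I del: index_mult_mat index_one_mat)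
  finally show ?thesis .
qed

lemma mcong_mult:
  assumes "0 < n"
    and "A \<in> carrier_mat n n" "B \<in> carrier_mat n n" "A' \<in> carrier_mat n n" "B' \<in> carrier_mat n n"
    and "mcong n 1 A' (1\<^sub>m n)" and "mcong n 1 B (1\<^sub>m n)"
    and AB: "mcong n m A A'" "mcong n m B B'"
  shows "mcong n m (A * B) (A' * B')"
  unfolding mcong_def
proof (intro allI impI)
  fix i j assume ij: "i < n" "j < n"
  have "wdvd n m i j ((A * B) $$ (i, j) - (A' * B') $$ (i, j)
      - (A $$ (i, j) - A' $$ (i, j)) - (B $$ (i, j) - B' $$ (i, j)))"
    by (rule wdvd_mono[OF mult_near[OF assms ij]]) simp
  moreover have "wdvd n m i j (A $$ (i, j) - A' $$ (i, j))" "wdvd n m i j (B $$ (i, j) - B' $$ (i, j))"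
    using AB ij by (simp_all add: mcong_def)
  ultimately have "wdvd n m i j ((A * B) $$ (i, j) - (A' * B') $$ (i, j)
      - (A $$ (i, j) - A' $$ (i, j)) - (B $$ (i, j) - B' $$ (i, j))
      + (B $$ (i, j) - B' $$ (i, j)) + (A $$ (i, j) - A' $$ (i, j)))"
    by (intro wdvd_add)
  then show "wdvd n m i j ((A * B) $$ (i, j) - (A' * B') $$ (i, j))"
    by (simp only: diff_add_cancel)
qed

definition list_mat_prod :: "nat \<Rightarrow> ('b \<Rightarrow> 'a::comm_ring_1 mat) \<Rightarrow> 'b list \<Rightarrow> 'a mat"
  where "list_mat_prod n G ks = foldr (\<lambda>a A. G a * A) ks (1\<^sub>m n)"

lemma list_mat_prod_simps [simp]:
  "list_mat_prod n G [] = 1\<^sub>m n"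
  "list_mat_prod n G (a # ks) = G a * list_mat_prod n G ks"
  by (simp_all add: list_mat_prod_def)

lemma list_mat_prod_carrier:
  "(\<And>a. a \<in> set ks \<Longrightarrow> G a \<in> carrier_mat n n) \<Longrightarrow> list_mat_prod n G ks \<in> carrier_mat n n"
  by (induction ks) (auto intro: mult_carrier_mat)

lemma list_mat_prod_append:
  "(\<And>a. a \<in> set ks \<union> set ls \<Longrightarrow> G a \<in> carrier_mat n n) \<Longrightarrow>
    list_mat_prod n G (ks @ ls) = list_mat_prod n G ks * list_mat_prod n G ls"
proof (induction ks)
  case Nil
  then show ?case
    using list_mat_prod_carrier[of ls G n] by simp
next
  case (Cons a ks)
  then show ?case
    using list_mat_prod_carrier[of ks G n] list_mat_prod_carrier[of ls G n]
    by (simp add: assoc_mult_mat[of "G a" n n _ n _ n])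
qed

lemma det_list_mat_prod:
  "(\<And>a. a \<in> set ks \<Longrightarrow> G a \<in> carrier_mat n n) \<Longrightarrow>
    det (list_mat_prod n G ks) = (\<Prod>a\<leftarrow>ks. det (G a))"
proof (induction ks)
  case (Cons a ks)
  then show ?case
    using list_mat_prod_carrier[of ks G n] by (simp add: det_mult[of _ n])
qed simp

lemma list_mat_prod_cong_1:
  assumes n: "0 < n" and "\<And>a. a \<in> set ks \<Longrightarrow> G a \<in> carrier_mat n n"
    and "\<And>a. a \<in> set ks \<Longrightarrow> mcong n 1 (G a) (1\<^sub>m n)"
  shows "mcong n 1 (list_mat_prod n G ks) (1\<^sub>m n)"
  using assms(2,3)
proof (induction ks)
  case (Cons a ks)
  then show ?case
    using mcong_mult[OF n, of "G a" "list_mat_prod n G ks" "1\<^sub>m n" "1\<^sub>m n" 1]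
      list_mat_prod_carrier[of ks G n] by (simp add: mcong_refl n del: One_nat_def)
qed (simp add: mcong_refl n)

text \<open>Iterate \<open>mult_near\<close> along the list. Both conclusions are carried through
  the induction because \<open>mult_near\<close> needs the congruence of the two tails.\<close>

lemma list_mat_prod_near:
  assumes n: "0 < n" and "\<And>a. a \<in> set ks \<Longrightarrow> G a \<in> carrier_mat n n" "\<And>a. a \<in> set ks \<Longrightarrow> H a \<in> carrier_mat n n"
    and "\<And>a. a \<in> set ks \<Longrightarrow> mcong n 1 (G a) (1\<^sub>m n)" "\<And>a. a \<in> set ks \<Longrightarrow> mcong n 1 (H a) (1\<^sub>m n)"
    and "\<And>a. a \<in> set ks \<Longrightarrow> mcong n m (G a) (H a)"
  shows "mcong n m (list_mat_prod n G ks) (list_mat_prod n H ks) \<and>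
    (\<forall>i<n. \<forall>j<n. wdvd n (Suc m) i j (list_mat_prod n G ks $$ (i, j) - list_mat_prod n H ks $$ (i, j)
      - (\<Sum>a\<leftarrow>ks. G a $$ (i, j) - H a $$ (i, j))))"
  using assms(2-)
proof (induction ks)
  case (Cons a ks)
  let ?P = "list_mat_prod n G ks" and ?Q = "list_mat_prod n H ks"
  have car: "G a \<in> carrier_mat n n" "?P \<in> carrier_mat n n" "H a \<in> carrier_mat n n" "?Q \<in> carrier_mat n n"
    using Cons.prems by (auto intro: list_mat_prod_carrier)
  have cong: "mcong n 1 (H a) (1\<^sub>m n)" "mcong n 1 ?P (1\<^sub>m n)" "mcong n m (G a) (H a)" "mcong n m ?P ?Q"
    using Cons by (auto intro!: list_mat_prod_cong_1 n simp del: One_nat_def)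
  note hyps = n car cong
  have "wdvd n (Suc m) i j ((G a * ?P) $$ (i, j) - (H a * ?Q) $$ (i, j)
      - (\<Sum>b\<leftarrow>a # ks. G b $$ (i, j) - H b $$ (i, j)))" if ij: "i < n" "j < n" for i j
  proof -
    have "wdvd n (Suc m) i j (?P $$ (i, j) - ?Q $$ (i, j) - (\<Sum>a\<leftarrow>ks. G a $$ (i, j) - H a $$ (i, j)))"
      using Cons ij by simp
    from wdvd_add[OF mult_near[OF hyps ij] this] show ?thesis
      by (simp add: algebra_simps del: index_mult_mat)
  qed
  then show ?case
    using mcong_mult[OF hyps] by simp
qed (simp_all add: mcong_refl wdvd_0 n)

section \<open>The elementary factors and their dependence on the parameters\<close>

text \<open>
  For \<open>i = j = n - 1\<close> the index \<open>Suc i\<close> is out of range, so the factor is \<open>diag(1, \<dots>, 1, u)\<close>.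
\<close>

definition gauss_factor :: "nat \<Rightarrow> 'a::comm_ring_1 mat \<Rightarrow> nat \<times> nat \<Rightarrow> 'a mat"
  where "gauss_factor n B = (\<lambda>(i, j). if i = j then coroot_elt n (i, Suc i) (1 + B $$ (i, i))
    else root_elt n (i, j) (B $$ (i, j)))"

lemma root_elt_carrier [simp]: "root_elt n \<alpha> t \<in> carrier_mat n n"
  by (simp add: root_elt_def)

lemma coroot_elt_carrier [simp]: "coroot_elt n \<delta> u \<in> carrier_mat n n"
  by (simp add: coroot_elt_def)

lemma gauss_factor_carrier [simp]: "gauss_factor n B a \<in> carrier_mat n n"
  by (simp add: gauss_factor_def split: prod.split)

lemma root_elt_index:
  "i < n \<Longrightarrow> j < n \<Longrightarrow> root_elt n \<alpha> t $$ (i, j) = 1\<^sub>m n $$ (i, j) + (if (i, j) = \<alpha> then t else 0)"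
  by (simp add: root_elt_def)

lemma coroot_elt_index:
  "i < n \<Longrightarrow> j < n \<Longrightarrow> coroot_elt n (k, Suc k) u $$ (i, j) = 1\<^sub>m n $$ (i, j) +
    (if i = j \<and> i = k then u - 1 else if i = j \<and> i = Suc k then unit_inv u - 1 else 0)"
  by (simp add: coroot_elt_def)

lemma gauss_factor_index:
  "i < n \<Longrightarrow> j < n \<Longrightarrow> gauss_factor n B (k, l) $$ (i, j) = 1\<^sub>m n $$ (i, j) +
    (if (i, j) = (k, l) then B $$ (i, j)
     else if k = l \<and> i = j \<and> i = Suc k then unit_inv (1 + B $$ (k, k)) - 1 else 0)"
  by (cases "k = l") (auto simp: gauss_factor_def root_elt_index coroot_elt_index)

text \<open>The exponent e = 0 works exactly above the diagonal, and e = 1 works everywhere because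
  i < n. Level 1 is thus the pattern of the pro-p Iwahori condition.\<close>

lemma wdvd_1_iff:
  assumes "i < n"
  shows "wdvd n 1 i j x \<longleftrightarrow> i < j \<or> padic_prime dvd x"
proof
  assume "wdvd n 1 i j x"
  then obtain e where "padic_prime ^ e dvd x" "1 + i \<le> e * n + j"
    by (auto simp: wdvd_def)
  then show "i < j \<or> padic_prime dvd x"
    by (cases e) (auto intro: dvd_mult_left)
next
  assume "i < j \<or> padic_prime dvd x"
  then show "wdvd n 1 i j x"
    unfolding wdvd_def using assms by (auto intro: exI[of _ 0] exI[of _ 1])
qed

lemma mcong_0_prime_dvd:
  assumes "mcong n 1 B (0\<^sub>m n n)" "i < n" "j \<le> i"
  shows "padic_prime dvd B $$ (i, j)"
proof -
  have "wdvd n 1 i j (B $$ (i, j))"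
    using assms by (simp add: mcong_def del: One_nat_def)
  then show ?thesis
    using assms by (simp add: wdvd_1_iff del: One_nat_def)
qed

text \<open>The difference of inverses is (v - u) times a unit congruent to 1 modulo p. So inversion
  preserves levels, and to first order it is a change of sign.\<close>

lemma wdvd_unit_inv:
  assumes u: "padic_prime dvd u - 1" "padic_prime dvd v - 1" and "wdvd n m i i (u - v)" and n: "0 < n"
  shows "wdvd n m i i (unit_inv u - unit_inv v)"
    and "wdvd n (Suc m) i i (unit_inv u - unit_inv v + (u - v))"
proof -
  have vu: "wdvd n m i i (v - u)"
    using assms wdvd_diff_commute by blast
  then show "wdvd n m i i (unit_inv u - unit_inv v)"
    unfolding unit_inv_diff[OF u] by (rule wdvd_multI) simp
  have "padic_prime dvd unit_inv u * unit_inv v - 1"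
    by (intro dvd_mult_minus_1 prime_dvd_unit_inv u)
  then have "wdvd n (m + 1) i i ((v - u) * (unit_inv u * unit_inv v - 1))"
    by (intro wdvd_mult[OF vu] wdvd_diag_of_prime_dvd n)
  then show "wdvd n (Suc m) i i (unit_inv u - unit_inv v + (u - v))"
    unfolding unit_inv_diff[OF u] by (simp add: algebra_simps)
qed

lemma gauss_factor_mcong:
  assumes n: "0 < n" and B: "mcong n 1 B (0\<^sub>m n n)" and C: "mcong n 1 C (0\<^sub>m n n)" and BC: "mcong n m B C"
    and a: "k < n" "l < n"
  shows "mcong n m (gauss_factor n B (k, l)) (gauss_factor n C (k, l))"
  unfolding mcong_def
proof (intro allI impI)
  fix i j assume ij: "i < n" "j < n"
  show "wdvd n m i j (gauss_factor n B (k, l) $$ (i, j) - gauss_factor n C (k, l) $$ (i, j))"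
  proof (cases "k = l \<and> i = j \<and> i = Suc k")
    \<comment> \<open>The only entry that is not a parameter itself: the inverse sits one place
      further down the diagonal, where levels are the same by
      \<open>wdvd_diag_shift\<close>.\<close>
    case True
    have "wdvd n m k k (B $$ (k, k) - C $$ (k, k))"
      using BC a by (simp add: mcong_def)
    then have "wdvd n m i i ((1 + B $$ (k, k)) - (1 + C $$ (k, k)))"
      using wdvd_diag_shift[of n m k "B $$ (k, k) - C $$ (k, k)" i] by simp
    from wdvd_unit_inv(1)[OF _ _ this n] show ?thesis
      using True ij mcong_0_prime_dvd[OF B a(1) order_refl] mcong_0_prime_dvd[OF C a(1) order_refl]
      by (simp add: gauss_factor_index)
  next
    case False
    then show ?thesis
      using ij BC n by (auto simp: gauss_factor_index mcong_def wdvd_0)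
  qed
qed

lemma gauss_factor_0: "gauss_factor n (0\<^sub>m n n) (k, l) = 1\<^sub>m n" if "k < n" "l < n"
  by (rule eq_matI) (use that in \<open>auto simp: gauss_factor_index unit_inv_1 carrier_matD[OF gauss_factor_carrier]
     simp del: index_one_mat(1)\<close>)

lemma gauss_factor_mcong_1:
  assumes n: "0 < n" and B: "mcong n 1 B (0\<^sub>m n n)" and a: "k < n" "l < n"
  shows "mcong n 1 (gauss_factor n B (k, l)) (1\<^sub>m n)"
  using gauss_factor_mcong[OF n B mcong_refl[OF n] B a] by (simp add: gauss_factor_0 a del: One_nat_def)

section \<open>First-order coordinates and the ordered product as a near-identity map\<close>

text \<open>
  To first order the factors with diagonal parameters \<open>b\<^sub>i\<close> contribute \<open>b\<^sub>i - b\<^bsub>i-1\<^esub>\<close> to the entry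
  \<open>(i, i)\<close>; using these differences as coordinates makes the ordered product close to the identity.
\<close>

definition diag_sums :: "nat \<Rightarrow> 'a::comm_ring_1 mat \<Rightarrow> 'a mat"
  where "diag_sums n C = mat n n (\<lambda>(i, j). if i = j then \<Sum>k\<le>i. C $$ (k, k) else C $$ (i, j))"

definition diag_diffs :: "nat \<Rightarrow> 'a::comm_ring_1 mat \<Rightarrow> 'a mat"
  where "diag_diffs n B = mat n n (\<lambda>(i, j). if i = j \<and> 0 < i then B $$ (i, i) - B $$ (i - 1, i - 1) else B $$ (i, j))"

lemma diag_sums_carrier [simp]: "diag_sums n C \<in> carrier_mat n n"
  by (simp add: diag_sums_def)

lemma diag_diffs_carrier [simp]: "diag_diffs n C \<in> carrier_mat n n"
  by (simp add: diag_diffs_def)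

lemma diag_sums_diffs:
  assumes "B \<in> carrier_mat n n"
  shows "diag_sums n (diag_diffs n B) = B"
proof -
  have "(\<Sum>k\<le>i. diag_diffs n B $$ (k, k)) = B $$ (i, i)" if "i < n" for i
    using that by (induction i) (simp_all add: diag_diffs_def)
  then show ?thesis
    using assms by (intro eq_matI) (auto simp: diag_sums_def diag_diffs_def[of n B])
qed

lemma diag_sums_mcong:
  assumes n: "0 < n" and CD: "mcong n m C D"
  shows "mcong n m (diag_sums n C) (diag_sums n D)"
proof -
  have "wdvd n m i i ((\<Sum>k\<le>i. C $$ (k, k)) - (\<Sum>k\<le>i. D $$ (k, k)))" if "i < n" for i
    unfolding sum_subtractf[symmetric]
  proof (rule wdvd_sum[OF n])
    fix k assume "k \<in> {..i}"
    with that CD have "wdvd n m k k (C $$ (k, k) - D $$ (k, k))"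
      by (simp add: mcong_def)
    then show "wdvd n m i i (C $$ (k, k) - D $$ (k, k))"
      using wdvd_diag_shift by blast
  qed
  then show ?thesis
    using CD by (simp add: mcong_def diag_sums_def)
qed

lemma diag_diffs_mcong:
  assumes n: "0 < n" and CD: "mcong n m C D"
  shows "mcong n m (diag_diffs n C) (diag_diffs n D)"
proof -
  have "wdvd n m i i ((C $$ (i, i) - C $$ (i - 1, i - 1)) - (D $$ (i, i) - D $$ (i - 1, i - 1)))" if "i < n" for i
  proof -
    have "wdvd n m (i - 1) (i - 1) (C $$ (i - 1, i - 1) - D $$ (i - 1, i - 1))"
      using CD that by (simp add: mcong_def)
    then have "wdvd n m i i (C $$ (i - 1, i - 1) - D $$ (i - 1, i - 1))"
      using wdvd_diag_shift by blast
    moreover have "wdvd n m i i (C $$ (i, i) - D $$ (i, i))"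
      using CD that by (simp add: mcong_def)
    ultimately have "wdvd n m i i ((C $$ (i, i) - D $$ (i, i)) - (C $$ (i - 1, i - 1) - D $$ (i - 1, i - 1)))"
      by - (rule wdvd_diff)
    then show ?thesis
      by (simp add: algebra_simps)
  qed
  then show ?thesis
    using CD by (simp add: mcong_def diag_diffs_def)
qed

lemma diag_sums_0 [simp]: "diag_sums n (0\<^sub>m n n) = 0\<^sub>m n n"
  by (rule eq_matI) (auto simp: diag_sums_def)

lemma diag_diffs_0 [simp]: "diag_diffs n (0\<^sub>m n n) = 0\<^sub>m n n"
  by (rule eq_matI) (auto simp: diag_diffs_def)

text \<open>The order of the factors is left open: the first-order estimate is a sum over the
  positions and does not see it.\<close>

locale gauss_order =
  fixes n :: nat and ks :: "(nat \<times> nat) list"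
  assumes n: "0 < n" and dist: "distinct ks" and set_ks: "set ks = {..<n} \<times> {..<n}"
begin

abbreviation "gprod B \<equiv> list_mat_prod n (gauss_factor n B) ks"

lemma gprod_carrier [simp]: "gprod B \<in> carrier_mat n n"
  by (rule list_mat_prod_carrier) simp

lemma gprod_cong_1:
  assumes "mcong n 1 B (0\<^sub>m n n)"
  shows "mcong n 1 (gprod B) (1\<^sub>m n)"
  by (rule list_mat_prod_cong_1[OF n]) (use assms in \<open>auto simp: set_ks n gauss_factor_mcong_1 simp del: One_nat_def\<close>)

lemma gauss_factor_sum:
  assumes ij: "i < n" "j < n"
  shows "(\<Sum>a\<leftarrow>ks. gauss_factor n B a $$ (i, j) - gauss_factor n B' a $$ (i, j)) =
    B $$ (i, j) - B' $$ (i, j) + (if i = j \<and> 0 < i then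
      unit_inv (1 + B $$ (i - 1, i - 1)) - unit_inv (1 + B' $$ (i - 1, i - 1)) else 0)"
proof -
  let ?f = "\<lambda>a. gauss_factor n B a $$ (i, j) - gauss_factor n B' a $$ (i, j)"
  \<comment> \<open>Only these factors touch the entry (i, j): its own, and on the diagonal the
    preceding torus factor through its inverse.\<close>
  let ?S = "if i = j \<and> 0 < i then {(i, j), (i - 1, i - 1)} else {(i, j)}"
  have "(\<Sum>a\<leftarrow>ks. ?f a) = sum ?f (set ks)"
    using dist by (simp add: sum_list_distinct_conv_sum_set)
  also have "\<dots> = sum ?f ?S"
    by (rule sum.mono_neutral_right) (use ij in \<open>auto simp: set_ks gauss_factor_index simp del: index_one_mat(1) split: if_splits\<close>)
  also have "\<dots> = B $$ (i, j) - B' $$ (i, j) + (if i = j \<and> 0 < i then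
      unit_inv (1 + B $$ (i - 1, i - 1)) - unit_inv (1 + B' $$ (i - 1, i - 1)) else 0)"
    using ij by (auto simp: gauss_factor_index simp del: index_one_mat(1))
  finally show ?thesis .
qed

lemma near_identity_gprod: "near_identity n 1 (\<lambda>C :: 'p::prime_card padic_int mat. gprod (diag_sums n C))"
proof
  fix m i j and C D :: "'p padic_int mat"
  assume C: "mcong n 1 C (0\<^sub>m n n)" and D: "mcong n 1 D (0\<^sub>m n n)" and CD: "mcong n m C D"
    and ij: "i < n" "j < n"
  let ?B = "diag_sums n C" and ?B' = "diag_sums n D"
  have B: "mcong n 1 ?B (0\<^sub>m n n)" "mcong n 1 ?B' (0\<^sub>m n n)" "mcong n m ?B ?B'"
    using diag_sums_mcong[OF n C] diag_sums_mcong[OF n D] diag_sums_mcong[OF n CD] by simp_all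
  have "wdvd n (Suc m) i j (gprod ?B $$ (i, j) - gprod ?B' $$ (i, j)
      - (\<Sum>a\<leftarrow>ks. gauss_factor n ?B a $$ (i, j) - gauss_factor n ?B' a $$ (i, j)))"
    using list_mat_prod_near[OF n, of ks "gauss_factor n ?B" "gauss_factor n ?B'" m] B ij
    by (auto simp: set_ks gauss_factor_mcong_1 gauss_factor_mcong n simp del: One_nat_def)
  moreover have "wdvd n (Suc m) i j ((\<Sum>a\<leftarrow>ks. gauss_factor n ?B a $$ (i, j) - gauss_factor n ?B' a $$ (i, j))
      - (C $$ (i, j) - D $$ (i, j)))"
  proof (cases "i = j \<and> 0 < i")
    case True
    define k where "k = i - 1"
    have k: "i = Suc k" "k < n"
      using True ij by (auto simp: k_def)
    have "wdvd n m k k (?B $$ (k, k) - ?B' $$ (k, k))"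
      using B(3) k by (simp add: mcong_def)
    then have "wdvd n m i i ((1 + ?B $$ (k, k)) - (1 + ?B' $$ (k, k)))"
      using wdvd_diag_shift[of n m k "?B $$ (k, k) - ?B' $$ (k, k)" i] by simp
    from wdvd_unit_inv(2)[OF _ _ this n]
    have "wdvd n (Suc m) i i (unit_inv (1 + ?B $$ (k, k)) - unit_inv (1 + ?B' $$ (k, k)) + ((1 + ?B $$ (k, k)) - (1 + ?B' $$ (k, k))))"
      using mcong_0_prime_dvd[OF B(1) k(2) order_refl] mcong_0_prime_dvd[OF B(2) k(2) order_refl] by simp
    \<comment> \<open>Consecutive partial sums differ by the coordinate C at (i, i), so the
      first-order contribution of the inverse, minus the preceding parameter, leaves exactly this
      coordinate.\<close>
    moreover have "?B $$ (i, i) = ?B $$ (k, k) + C $$ (i, i)" "?B' $$ (i, i) = ?B' $$ (k, k) + D $$ (i, i)"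
      using ij(1) k(2) by (simp_all add: diag_sums_def k(1))
    ultimately show ?thesis
      unfolding gauss_factor_sum[OF ij] using True k(1) by (auto simp: algebra_simps)
  next
    case False
    then have "(\<Sum>a\<leftarrow>ks. gauss_factor n ?B a $$ (i, j) - gauss_factor n ?B' a $$ (i, j)) = C $$ (i, j) - D $$ (i, j)"
      unfolding gauss_factor_sum[OF ij] using ij by (auto simp: diag_sums_def)
    then show ?thesis
      by (simp add: wdvd_0 n)
  qed
  ultimately show "wdvd n (Suc m) i j (gprod ?B $$ (i, j) - gprod ?B' $$ (i, j) - (C $$ (i, j) - D $$ (i, j)))"
    by (rule wdvd_trans)
qed (simp_all add: n)

text \<open>Pass to the difference coordinates, where the near-identity property applies, and back;
  both changes of coordinates preserve levels. The case m = 0 lies below the starting level 1 of the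
  locale, and there both sides hold.\<close>

lemma gprod_mcong_iff:
  assumes B: "B \<in> carrier_mat n n" "mcong n 1 B (0\<^sub>m n n)"
    and B': "B' \<in> carrier_mat n n" "mcong n 1 B' (0\<^sub>m n n)" 
  shows "mcong n m (gprod B) (gprod B') \<longleftrightarrow> mcong n m B B'"
proof (cases "m = 0")
  case True
  have "mcong n 1 B B'"
    using B(2) mcong_sym[OF B'(2)] by (rule mcong_trans)
  moreover have "mcong n 1 (gprod B) (gprod B')"
    using gprod_cong_1[OF B(2)] mcong_sym[OF gprod_cong_1[OF B'(2)]] by (rule mcong_trans)
  ultimately show ?thesis
    using True mcong_mono[of n 1 _ _ 0] by blast
next
  case False
  then have m: "1 \<le> m"
    by simp
  interpret near_identity n 1 "\<lambda>C. gprod (diag_sums n C)"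
    by (rule near_identity_gprod)
  have "mcong n m (gprod B) (gprod B') \<longleftrightarrow> mcong n m (diag_diffs n B) (diag_diffs n B')"
    using mcong_F_iff[of "diag_diffs n B" "diag_diffs n B'" m] diag_diffs_mcong[OF n B(2)] diag_diffs_mcong[OF n B'(2)] m
    by (simp add: diag_sums_diffs B(1) B'(1))
  then show ?thesis
    using diag_diffs_mcong[OF n, of m B B'] diag_sums_mcong[OF n, of m "diag_diffs n B" "diag_diffs n B'"]
    by (auto simp: diag_sums_diffs B(1) B'(1))
qed

lemma gprod_0: "gprod (0\<^sub>m n n :: 'a::comm_ring_1 mat) = 1\<^sub>m n"
proof -
  have "list_mat_prod n (gauss_factor n (0\<^sub>m n n :: 'a mat)) ls = 1\<^sub>m n" if "set ls \<subseteq> {..<n} \<times> {..<n}" for ls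
    using that by (induction ls) (auto simp: gauss_factor_0)
  then show ?thesis
    by (simp add: set_ks)
qed

lemma gprod_surj:
  assumes "A \<in> carrier_mat n n" "mcong n 1 A (1\<^sub>m n)"
  obtains B where "B \<in> carrier_mat n n" "mcong n 1 B (0\<^sub>m n n)" "gprod B = A"
proof -
  interpret near_identity n 1 "\<lambda>C. gprod (diag_sums n C)"
    by (rule near_identity_gprod)
  obtain C where "mcong n 1 C (0\<^sub>m n n)" "gprod (diag_sums n C) = A"
    using F_surj[OF assms(1)] assms(2) by (auto simp: gprod_0)
  then show ?thesis
    using that[of "diag_sums n C"] diag_sums_mcong[OF n, of 1 C "0\<^sub>m n n"] by simp
qed

end

section \<open>Determinants and p-adic powers of the factors\<close>

lemma det_root_elt:
  assumes "k \<noteq> l"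
  shows "det (root_elt n (k, l) t) = 1"
proof -
  have "root_elt n (k, l) t = addrow_mat n t k l"
    by (rule eq_matI) (auto simp: root_elt_def addrow_mat_def)
  then show ?thesis
    using assms by (simp add: det_addrow_mat)
qed

lemma det_coroot_elt:
  assumes "k < n"
  shows "det (coroot_elt n (k, Suc k) u) = (if Suc k < n then u * unit_inv u else u)"
proof -
  let ?f = "\<lambda>i. if i = k then u else if i = Suc k then unit_inv u else 1"
  have "det (coroot_elt n (k, Suc k) u) = (\<Prod>i\<in>{0..<n}. coroot_elt n (k, Suc k) u $$ (i, i))"
    by (subst det_lower_triangular[of n])
      (auto simp: prod_list_diag_prod coroot_elt_def)
  also have "\<dots> = prod ?f {0..<n}"
    by (rule prod.cong) (auto simp: coroot_elt_def)
  also have "\<dots> = prod ?f ({k, Suc k} \<inter> {0..<n})"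
    by (rule prod.mono_neutral_right) auto
  also have "{k, Suc k} \<inter> {0..<n} = (if Suc k < n then {k, Suc k} else {k})"
    using assms by auto
  finally show ?thesis
    by auto
qed

text \<open>Root factors and the torus factors other than the last have determinant 1. The last
  torus factor has no place for the inverse entry and contributes its parameter.\<close>

lemma (in gauss_order) det_gprod:
  fixes B :: "'p::prime_card padic_int mat"
  assumes B: "mcong n 1 B (0\<^sub>m n n)"
  shows "det (gprod B) = 1 + B $$ (n - 1, n - 1)"
proof -
  obtain L where L: "n = Suc L"
    using n by (cases n) auto
  have "det (gauss_factor n B (k, l)) = (if (k, l) = (L, L) then 1 + B $$ (L, L) else 1)"
    if "k < n" "l < n" for k l
    using that mcong_0_prime_dvd[OF B \<open>k < n\<close> order_refl]
    by (auto simp: gauss_factor_def det_root_elt det_coroot_elt padic_unit_inv L)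
  note fac = this
  have "det (gprod B) = (\<Prod>a\<in>set ks. det (gauss_factor n B a))"
    by (simp add: det_list_mat_prod prod.distinct_set_conv_list[OF dist])
  also have "\<dots> = (\<Prod>a\<in>set ks. if a = (L, L) then 1 + B $$ (L, L) else 1)"
    by (rule prod.cong) (auto simp: set_ks fac split: if_splits)
  also have "\<dots> = 1 + B $$ (L, L)"
    by (simp add: prod.delta set_ks L)
  finally show ?thesis
    by (simp add: L)
qed

section \<open>p-adic powers of the root and torus elements\<close>

lemma root_elt_mult:
  assumes "k \<noteq> l"
  shows "root_elt n (k, l) s * root_elt n (k, l) t = root_elt n (k, l) (s + t)"
proof (rule eq_matI)
  fix i j assume "i < dim_row (root_elt n (k, l) (s + t))" "j < dim_col (root_elt n (k, l) (s + t))"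
  then have ij: "i < n" "j < n"
    by (simp_all add: root_elt_def)
  let ?e = "\<lambda>u (i, j). (if i = j then 1 else 0) + (if (i, j) = (k, l) then u else 0)"
  have "(root_elt n (k, l) s * root_elt n (k, l) t) $$ (i, j) = (\<Sum>r\<in>{0..<n}. ?e s (i, r) * ?e t (r, j))"
    using ij by (auto simp: scalar_prod_def root_elt_def intro!: sum.cong)
  \<comment> \<open>Row i of the left factor is nonzero at most at r = i and, when i = k, at r = l.
    As k and l differ, no product s * t survives in the next step.\<close>
  also have "\<dots> = (\<Sum>r\<in>{0..<n}. (if r = i then ?e t (i, j) else 0) + (if r = l then if i = k then s * ?e t (l, j) else 0 else 0))"
    by (rule sum.cong) (auto simp: algebra_simps)
  also have "\<dots> = root_elt n (k, l) (s + t) $$ (i, j)"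
    using ij assms by (auto simp: sum.distrib sum.delta root_elt_def)
  finally show "(root_elt n (k, l) s * root_elt n (k, l) t) $$ (i, j) = root_elt n (k, l) (s + t) $$ (i, j)" .
qed (simp_all add: root_elt_def)

lemma root_elt_0: "root_elt n \<alpha> 0 = 1\<^sub>m n"
  by (rule eq_matI) (auto simp: root_elt_def)

lemma root_elt_power: "k \<noteq> l \<Longrightarrow> root_elt n (k, l) t ^\<^sub>m N = root_elt n (k, l) (of_nat N * t)"
  by (induction N) (simp_all add: root_elt_0 root_elt_mult algebra_simps carrier_matD[OF root_elt_carrier])

lemma padic_pow_root_elt:
  fixes t z :: "'p::prime_card padic_int"
  assumes "k \<noteq> l"
  shows "padic_pow (root_elt n (k, l) t) z = root_elt n (k, l) (z * t)"
proof (rule eq_matI)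
  fix i j assume "i < dim_row (root_elt n (k, l) (z * t))" "j < dim_col (root_elt n (k, l) (z * t))"
  then have ij: "i < n" "j < n"
    by (simp_all add: root_elt_def)
  let ?N = "\<lambda>r. nat (padic_res z r)"
  have "(\<lambda>r. root_elt n (k, l) (of_nat (?N r) * t) $$ (i, j)) \<longlonglongrightarrow> root_elt n (k, l) (z * t) $$ (i, j)"
  proof (rule padic_tendstoI)
    fix r
    have "padic_prime ^ r dvd (of_nat (?N r) - z) * t"
      using padic_prime_power_dvd_res[of r z] by (simp only: dvd_diff_swap dvd_mult2)
    then show "padic_prime ^ r dvd root_elt n (k, l) (of_nat (?N r) * t) $$ (i, j) - root_elt n (k, l) (z * t) $$ (i, j)"
      using ij by (simp add: root_elt_index left_diff_distrib)
  qed
  then show "padic_pow (root_elt n (k, l) t) z $$ (i, j) = root_elt n (k, l) (z * t) $$ (i, j)"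
    using ij assms by (simp add: padic_pow_def root_elt_power limI carrier_matD[OF root_elt_carrier])
qed (simp_all add: padic_pow_def root_elt_def)

lemma coroot_elt_mult:
  assumes "padic_prime dvd u - 1" "padic_prime dvd v - 1"
  shows "coroot_elt n \<delta> u * coroot_elt n \<delta> v = coroot_elt n \<delta> (u * v :: 'p::prime_card padic_int)"
proof (rule eq_matI)
  fix i j assume "i < dim_row (coroot_elt n \<delta> (u * v))" "j < dim_col (coroot_elt n \<delta> (u * v))"
  then have ij: "i < n" "j < n"
    by (simp_all add: coroot_elt_def)
  have "u * v * (unit_inv u * unit_inv v) = (u * unit_inv u) * (v * unit_inv v)"
    by (simp only: mult_ac)
  then have inv: "unit_inv (u * v) = unit_inv u * unit_inv v"
    by (intro unit_inv_eqI) (simp add: padic_unit_inv assms)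
  let ?e = "\<lambda>u i. if i = fst \<delta> then u else if i = snd \<delta> then unit_inv u else 1"
  have "(coroot_elt n \<delta> u * coroot_elt n \<delta> v) $$ (i, j)
    = (\<Sum>r\<in>{0..<n}. (if i \<noteq> r then 0 else ?e u i) * (if r \<noteq> j then 0 else ?e v r))"
    using ij by (simp add: scalar_prod_def coroot_elt_def)
  also have "\<dots> = (\<Sum>r\<in>{0..<n}. if r = i then if i \<noteq> j then 0 else ?e u i * ?e v i else 0)"
    by (rule sum.cong) auto
  also have "\<dots> = coroot_elt n \<delta> (u * v) $$ (i, j)"
    using ij by (auto simp: sum.delta coroot_elt_def inv)
  finally show "(coroot_elt n \<delta> u * coroot_elt n \<delta> v) $$ (i, j) = coroot_elt n \<delta> (u * v) $$ (i, j)" .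
qed (simp_all add: coroot_elt_def)

lemma coroot_elt_1: "coroot_elt n \<delta> 1 = 1\<^sub>m n"
  by (rule eq_matI) (auto simp: coroot_elt_def unit_inv_1)

lemma coroot_elt_power:
  fixes u :: "'p::prime_card padic_int"
  assumes "padic_prime dvd u - 1"
  shows "coroot_elt n \<delta> u ^\<^sub>m N = coroot_elt n \<delta> (u ^ N)"
  by (induction N) (simp_all add: coroot_elt_1 coroot_elt_mult dvd_power_minus_1 assms mult.commute
      carrier_matD[OF coroot_elt_carrier])

lemma padic_pow_coroot_elt:
  fixes z :: "'p::prime_card padic_int"
  assumes p: "CARD('p) > 2"
  shows "padic_pow (coroot_elt n (k, Suc k) (1 + padic_prime)) z = coroot_elt n (k, Suc k) (one_plus_prime_pow z)"
proof (rule eq_matI)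
  let ?p = "padic_prime :: 'p padic_int"
  fix i j assume "i < dim_row (coroot_elt n (k, Suc k) (one_plus_prime_pow z))"
    "j < dim_col (coroot_elt n (k, Suc k) (one_plus_prime_pow z))"
  then have ij: "i < n" "j < n"
    by (simp_all add: coroot_elt_def)
  let ?u = "\<lambda>r. (1 + ?p) ^ nat (padic_res z r)"
  have u: "?p dvd ?u r - 1" for r
    by (rule dvd_power_minus_1) simp
  have "(\<lambda>r. coroot_elt n (k, Suc k) (?u r) $$ (i, j)) \<longlonglongrightarrow> coroot_elt n (k, Suc k) (one_plus_prime_pow z) $$ (i, j)"
  proof (rule padic_tendstoI)
    fix r
    have d: "?p ^ r dvd one_plus_prime_pow z - ?u r"
      using one_plus_prime_pow_approx[OF p, of r z] by (rule dvd_trans[rotated]) simp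
    then have "?p ^ r dvd unit_inv (?u r) - unit_inv (one_plus_prime_pow z)"
      unfolding unit_inv_diff[OF u prime_dvd_one_plus_prime_pow[OF p]] by (rule dvd_mult2)
    then show "?p ^ r dvd coroot_elt n (k, Suc k) (?u r) $$ (i, j) - coroot_elt n (k, Suc k) (one_plus_prime_pow z) $$ (i, j)"
      using ij d by (auto simp: coroot_elt_index dvd_diff_swap[of _ "?u r"])
  qed
  then show "padic_pow (coroot_elt n (k, Suc k) (1 + padic_prime)) z $$ (i, j)
      = coroot_elt n (k, Suc k) (one_plus_prime_pow z) $$ (i, j)"
    using ij by (simp add: padic_pow_def coroot_elt_power limI carrier_matD[OF coroot_elt_carrier])
qed (simp_all add: padic_pow_def coroot_elt_def)

section \<open>The generators and their powers in terms of factor parameters\<close>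

definition gen_mat :: "nat \<Rightarrow> 'p::prime_card padic_int mat"
  where "gen_mat n = mat n n (\<lambda>(i, j). if i < j then 1 else padic_prime)"

text \<open>Holds the parameters of the powers of the generators: x(t)^z = x(z t) at a root, and (1
  + p)^z - 1 on the diagonal because \<open>gauss_factor\<close> adds 1 there.\<close>

definition coord_mat :: "nat \<Rightarrow> (nat \<times> nat \<Rightarrow> 'p::prime_card padic_int) \<Rightarrow> 'p padic_int mat"
  where "coord_mat n f = mat n n (\<lambda>(i, j). if i = j then one_plus_prime_pow (f (i, i)) - 1
    else gen_mat n $$ (i, j) * f (i, j))"

lemma gen_mat_index: "i < n \<Longrightarrow> j < n \<Longrightarrow> gen_mat n $$ (i, j) = (if i < j then 1 else padic_prime)"
  by (simp add: gen_mat_def)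

lemma coord_mat_carrier [simp]: "coord_mat n f \<in> carrier_mat n n"
  by (simp add: coord_mat_def)

lemma coord_mat_index: "i < n \<Longrightarrow> j < n \<Longrightarrow> coord_mat n f $$ (i, j) =
    (if i = j then one_plus_prime_pow (f (i, i)) - 1 else gen_mat n $$ (i, j) * f (i, j))"
  by (simp add: coord_mat_def)

lemma gen_mat_mcong: "mcong n 1 (gen_mat n) (0\<^sub>m n n)"
  by (auto simp: mcong_def gen_mat_index wdvd_1_iff simp del: One_nat_def)

lemma padic_pow_gauss_factor:
  fixes f :: "nat \<times> nat \<Rightarrow> 'p::prime_card padic_int"
  assumes p: "CARD('p) > 2" and "i < n" "j < n"
  shows "padic_pow (gauss_factor n (gen_mat n) (i, j)) (f (i, j)) = gauss_factor n (coord_mat n f) (i, j)"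
  using assms by (simp add: gauss_factor_def coord_mat_index gen_mat_index padic_pow_root_elt padic_pow_coroot_elt mult.commute)

lemma wdvd_one_plus_prime_pow:
  fixes z w :: "'p::prime_card padic_int"
  assumes p: "CARD('p) > 2"
  shows "wdvd n m i j (one_plus_prime_pow z - one_plus_prime_pow w) \<longleftrightarrow> wdvd n m i j (padic_prime * (z - w))"
  unfolding wdvd_def one_plus_prime_pow_dvd_iff[OF p] ..

text \<open>On the diagonal, (1 + p)^z - (1 + p)^w has the same divisibility as p * (z - w). Hence
  all positions obey one linear criterion, although the diagonal coordinates are not linear.\<close>

lemma coord_mat_mcong_iff:
  fixes f g :: "nat \<times> nat \<Rightarrow> 'p::prime_card padic_int"
  assumes p: "CARD('p) > 2"
  shows "mcong n m (coord_mat n f) (coord_mat n g) \<longleftrightarrow>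
    (\<forall>i<n. \<forall>j<n. wdvd n m i j (gen_mat n $$ (i, j) * (f (i, j) - g (i, j))))"
proof -
  have "wdvd n m i j (coord_mat n f $$ (i, j) - coord_mat n g $$ (i, j)) \<longleftrightarrow>
      wdvd n m i j (gen_mat n $$ (i, j) * (f (i, j) - g (i, j)))" if "i < n" "j < n" for i j
    using that wdvd_one_plus_prime_pow[OF p, of n m i i "f (i, i)" "g (i, i)"]
    by (cases "i = j") (simp_all add: coord_mat_index gen_mat_index right_diff_distrib)
  then show ?thesis
    by (simp add: mcong_def)
qed

lemma coord_mat_0:
  assumes p: "CARD('p::prime_card) > 2"
  shows "coord_mat n (\<lambda>_. 0 :: 'p padic_int) = 0\<^sub>m n n"
  by (rule eq_matI) (auto simp: coord_mat_def one_plus_prime_pow_0[OF p])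

lemma coord_mat_mcong_0:
  fixes f :: "nat \<times> nat \<Rightarrow> 'p::prime_card padic_int"
  assumes p: "CARD('p) > 2"
  shows "mcong n 1 (coord_mat n f) (0\<^sub>m n n)"
  using coord_mat_mcong_iff[OF p, of n 1 f "\<lambda>_. 0"]
  by (auto simp: coord_mat_0[OF p] wdvd_1_iff gen_mat_index simp del: One_nat_def)

text \<open>Solved entry by entry: nothing to do above the diagonal, division by p below it, and
  \<open>one_plus_prime_pow_surj\<close> on it.\<close>

lemma coord_mat_surj:
  fixes B :: "'p::prime_card padic_int mat"
  assumes p: "CARD('p) > 2" and B: "B \<in> carrier_mat n n" "mcong n 1 B (0\<^sub>m n n)"
  obtains f where "coord_mat n f = B"
proof -
  have "\<exists>x. B $$ (i, j) = (if i = j then one_plus_prime_pow x - 1 else gen_mat n $$ (i, j) * x)" if ij: "i < n" "j < n" for i j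
  proof -
    consider "i < j" | "i = j" | "j < i"
      by linarith
    then show ?thesis
    proof cases
      case 2
      then have "padic_prime dvd (1 + B $$ (i, j)) - 1"
        using mcong_0_prime_dvd[OF B(2) ij(1)] by simp
      from one_plus_prime_pow_surj[OF p this] obtain x where "one_plus_prime_pow x = 1 + B $$ (i, j)" ..
      then show ?thesis
        using 2 by (auto intro!: exI[of _ x])
    next
      case 3
      then have "padic_prime dvd B $$ (i, j)"
        using mcong_0_prime_dvd[OF B(2) ij(1)] by simp
      then show ?thesis
        using 3 ij by (auto simp: gen_mat_index elim: dvdE)
    qed (use ij in \<open>auto simp: gen_mat_index\<close>)
  qed
  then obtain f where "\<And>i j. i < n \<Longrightarrow> j < n \<Longrightarrow>
      B $$ (i, j) = (if i = j then one_plus_prime_pow (f i j) - 1 else gen_mat n $$ (i, j) * f i j)"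
    by metis
  then have "coord_mat n (\<lambda>(i, j). f i j) = B"
    using B(1) by (intro eq_matI) (auto simp: coord_mat_def)
  then show ?thesis
    by (rule that)
qed

section \<open>The valuation and the ordered basis\<close>

lemma le_entry_val_iff:
  assumes n: "0 < n"
  shows "ereal (real m / real n) \<le> ereal (real_of_int (height (i, j)) / real n) + ereal_of_enat (padic_val x)
    \<longleftrightarrow> wdvd n m i j x"
proof (cases "padic_val x")
  case (enat v)
  have "wdvd n m i j x \<longleftrightarrow> (\<exists>e\<le>v. m + i \<le> e * n + j)"
    unfolding wdvd_def padic_val_ge_iff[symmetric] enat by auto
  also have "\<dots> \<longleftrightarrow> m + i \<le> v * n + j"
    by (meson add_le_mono1 le_trans mult_le_mono1 order_refl)
  also have "\<dots> \<longleftrightarrow> real (m + i) \<le> real (v * n + j)"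
    by (simp only: of_nat_le_iff)
  also have "\<dots> \<longleftrightarrow> real m \<le> real j - real i + real v * real n"
    by (simp add: algebra_simps)
  also have "\<dots> \<longleftrightarrow> real m / real n \<le> (real j - real i) / real n + real v"
    using n by (simp add: field_simps)
  finally show ?thesis
    using enat by (simp add: height_def)
next
  case infinity
  then have "x = 0"
    by (simp add: padic_val_def split: if_splits)
  then show ?thesis
    using infinity n by (simp add: wdvd_0)
qed

lemma finite_roots: "finite (roots n)"
  by (rule finite_subset[of _ "{..<n} \<times> {..<n}"]) (auto simp: roots_def)

lemma roots_nonempty:
  assumes "2 \<le> n"
  shows "roots n \<noteq> {}"
proof -
  have "(0, 1) \<in> roots n"
    using assms by (simp add: roots_def)
  then show ?thesis
    by blast
qed

text \<open>The bridge from the valuation to the filtration: at level m, minima become conjunctions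
  of entry conditions.\<close>

lemma le_iwahori_val_iff:
  assumes n: "2 \<le> n"
  shows "ereal (real m / real n) \<le> iwahori_val n A \<longleftrightarrow> mcong n m A (1\<^sub>m n)"
proof -
  have n0: "0 < n"
    using n by simp
  have "ereal (real m / real n) \<le> iwahori_val n A \<longleftrightarrow>
      (\<forall>(i, j)\<in>roots n. wdvd n m i j (A $$ (i, j))) \<and> (\<forall>i\<in>{..<n}. wdvd n m i i (A $$ (i, i) - 1))"
  proof -
    have diag: "ereal (real m / real n) \<le> ereal_of_enat (padic_val (A $$ (i, i) - 1)) \<longleftrightarrow> wdvd n m i i (A $$ (i, i) - 1)" for i
      using le_entry_val_iff[OF n0, of m i i "A $$ (i, i) - 1"] by (simp add: height_def)
    have off: "ereal (real m / real n) \<le> ereal (real_of_int (height a) / real n) + ereal_of_enat (padic_val (A $$ a))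
        \<longleftrightarrow> (case a of (i, j) \<Rightarrow> wdvd n m i j (A $$ (i, j)))" for a
      by (cases a) (simp add: le_entry_val_iff[OF n0])
    show ?thesis
      unfolding iwahori_val_def min.bounded_iff
      using n0 roots_nonempty[OF n]
      by (simp add: finite_roots lessThan_empty_iff diag off)
  qed
  then show ?thesis
    by (auto simp: mcong_def roots_def)
qed

text \<open>The possible values of the valuation. On this discrete set a nonnegative value is
  determined by which thresholds m/n it reaches, so equalities of valuations reduce to equivalences
  of congruences.\<close>

definition grid :: "nat \<Rightarrow> ereal set"
  where "grid n = insert \<infinity> (range (\<lambda>q::int. ereal (real_of_int q / real n)))"

lemma entry_val_grid:
  assumes "0 < n"
  shows "ereal (real_of_int q / real n) + ereal_of_enat v \<in> grid n"
proof (cases v)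
  case (enat k)
  have "ereal (real_of_int q / real n) + ereal_of_enat v = ereal (real_of_int (q + int k * int n) / real n)"
    using assms enat by (simp add: field_simps)
  then show ?thesis
    unfolding grid_def by blast
qed (simp add: grid_def)

lemma iwahori_val_grid:
  assumes n: "2 \<le> n"
  shows "iwahori_val n A \<in> grid n"
proof -
  let ?f = "\<lambda>(i, j). ereal (real_of_int (height (i, j)) / real n) + ereal_of_enat (padic_val (A $$ (i, j)))"
  let ?g = "\<lambda>i. ereal_of_enat (padic_val (A $$ (i, i) - 1))"
  have "Min (?f ` roots n) \<in> ?f ` roots n"
    using roots_nonempty[OF n] finite_roots by (intro Min_in) auto
  then have "Min (?f ` roots n) \<in> grid n"
    using n by (auto simp: entry_val_grid)
  moreover have "Min (?g ` {..<n}) \<in> ?g ` {..<n}"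
    using n by (intro Min_in) (auto simp: lessThan_empty_iff)
  then have "Min (?g ` {..<n}) \<in> grid n"
    using n entry_val_grid[of n 0] by (auto simp flip: zero_ereal_def)
  ultimately show ?thesis
    by (simp add: iwahori_val_def min_def)
qed

lemma grid_eqI:
  assumes n: "0 < n" and x: "x \<in> grid n" "0 \<le> x" and y: "y \<in> grid n" "0 \<le> y"
    and iff: "\<And>m::nat. ereal (real m / real n) \<le> x \<longleftrightarrow> ereal (real m / real n) \<le> y"
  shows "x = y"
proof -
  have "x \<le> y" if x: "x \<in> grid n" "0 \<le> x" and y: "y \<in> grid n" "0 \<le> y"
    and iff: "\<And>m::nat. ereal (real m / real n) \<le> x \<longleftrightarrow> ereal (real m / real n) \<le> y" for x y :: ereal
  proof (cases "x = \<infinity>")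
    case False
    then obtain q where q: "x = ereal (real_of_int q / real n)"
      using x(1) by (auto simp: grid_def)
    then have "x = ereal (real (nat q) / real n)"
      using x(2) n by (simp add: zero_le_divide_iff)
    then show ?thesis
      using iff[of "nat q"] by simp
  next
    case True
    have "y = \<infinity>"
    proof (rule ccontr)
      assume "y \<noteq> \<infinity>"
      then obtain q where q: "y = ereal (real_of_int q / real n)"
        using y(1) by (auto simp: grid_def)
      \<comment> \<open>The threshold directly above y: an infinite x reaches it, while y does
        not.\<close>
      have "ereal (real (Suc (nat q)) / real n) \<le> y"
        using iff[of "Suc (nat q)"] True by simp
      then show False
        using y(2) n by (simp add: q divide_le_cancel zero_le_divide_iff)
    qed
    then show ?thesis
      by simp
  qed
  from this[OF x y iff] this[OF y x iff[symmetric]] show ?thesis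
    by simp
qed

lemma enat_le_enatI: "(\<And>k. enat k \<le> x \<Longrightarrow> enat k \<le> y) \<Longrightarrow> x \<le> y"
proof (cases x)
  case infinity
  assume *: "\<And>k. enat k \<le> x \<Longrightarrow> enat k \<le> y"
  have "y = \<infinity>"
  proof (cases y)
    case (enat l)
    then show ?thesis
      using *[of "Suc l"] infinity by simp
  qed simp
  then show ?thesis
    by simp
qed simp

lemma padic_val_gen_mat_mult:
  fixes z :: "'p::prime_card padic_int"
  assumes "i < n" "j < n"
  shows "padic_val (gen_mat n $$ (i, j) * z) = padic_val (gen_mat n $$ (i, j) :: 'p padic_int) + padic_val z"
proof -
  have *: "padic_val (padic_prime * x) = 1 + padic_val x" for x :: "'p padic_int"
  proof -
    have "enat k \<le> padic_val (padic_prime * x) \<longleftrightarrow> enat k \<le> 1 + padic_val x" for k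
    proof (cases k)
      case (Suc l)
      have "enat (Suc l) \<le> 1 + padic_val x \<longleftrightarrow> enat l \<le> padic_val x"
        by (cases "padic_val x") (simp_all add: one_enat_def)
      then show ?thesis
        by (simp only: Suc padic_val_ge_iff padic_prime_mult_dvd_iff)
    qed (simp flip: zero_enat_def)
    then show ?thesis
      by (intro order.antisym) (rule enat_le_enatI, simp)+
  qed
  have "padic_val (1 :: 'p padic_int) = 0"
  proof -
    have "\<not> enat 1 \<le> padic_val (1 :: 'p padic_int)"
      unfolding padic_val_ge_iff padic_prime_power_dvd_iff one_padic_int.rep_eq
      using padic_int_gt_1[where 'p='p] by simp
    then show ?thesis
      by (cases "padic_val (1 :: 'p padic_int)") (auto simp: enat_0_iff)
  qed
  then show ?thesis
    using assms *[of z] *[of 1] by (simp add: gen_mat_index)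
qed

text \<open>A torus factor also carries an inverse entry, but this is congruent to 1 at the same
  level as the parameter and adds no condition.\<close>

lemma gauss_factor_mcong_one_iff:
  assumes n: "0 < n" and B: "mcong n 1 B (0\<^sub>m n n)" and kl: "k < n" "l < n"
  shows "mcong n m (gauss_factor n B (k, l)) (1\<^sub>m n) \<longleftrightarrow> wdvd n m k l (B $$ (k, l))"
proof
  assume "mcong n m (gauss_factor n B (k, l)) (1\<^sub>m n)"
  then have "wdvd n m k l (gauss_factor n B (k, l) $$ (k, l) - 1\<^sub>m n $$ (k, l))"
    using kl by (simp only: mcong_def)
  then show "wdvd n m k l (B $$ (k, l))"
    using kl by (simp add: gauss_factor_index del: index_one_mat)
next
  assume w: "wdvd n m k l (B $$ (k, l))"
  show "mcong n m (gauss_factor n B (k, l)) (1\<^sub>m n)"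
    unfolding mcong_def
  proof (intro allI impI)
    fix i j assume ij: "i < n" "j < n"
    show "wdvd n m i j (gauss_factor n B (k, l) $$ (i, j) - 1\<^sub>m n $$ (i, j))"
    proof (cases "k = l \<and> i = j \<and> i = Suc k")
      case True
      have "wdvd n m i i ((1 + B $$ (k, k)) - 1)"
        using w True wdvd_diag_shift[of n m k "B $$ (k, k)" i] by simp
      from wdvd_unit_inv(1)[OF _ _ this n] show ?thesis
        using True ij mcong_0_prime_dvd[OF B kl(1) order_refl]
        by (simp add: gauss_factor_index unit_inv_1 del: index_one_mat)
    next
      case False
      then show ?thesis
        using ij w n by (auto simp: gauss_factor_index wdvd_0 simp del: index_one_mat)
    qed
  qed
qed

lemma iwahori_val_gen:
  assumes n: "2 \<le> n" and ij: "i < n" "j < n"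
  shows "iwahori_val n (gauss_factor n (gen_mat n :: 'p::prime_card padic_int mat) (i, j))
    = ereal (real_of_int (height (i, j)) / real n) + ereal_of_enat (padic_val (gen_mat n $$ (i, j) :: 'p padic_int))"
    (is "?x = ?y")
proof (rule grid_eqI)
  show n0: "0 < n"
    using n by simp
  show iff: "ereal (real m / real n) \<le> ?x \<longleftrightarrow> ereal (real m / real n) \<le> ?y" for m
    by (simp only: le_iwahori_val_iff[OF n] le_entry_val_iff[OF n0] gauss_factor_mcong_one_iff[OF n0 gen_mat_mcong ij])
  have "wdvd n 1 i j (gen_mat n $$ (i, j) :: 'p padic_int)"
    using gen_mat_mcong[of n, where 'a='p] ij by (simp add: mcong_def del: One_nat_def)
  then have "wdvd n 0 i j (gen_mat n $$ (i, j) :: 'p padic_int)"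
    by (rule wdvd_mono) simp
  then show "0 \<le> ?y"
    using le_entry_val_iff[OF n0, of 0 i j "gen_mat n $$ (i, j) :: 'p padic_int"] by (simp flip: zero_ereal_def)
  then show "0 \<le> ?x"
    using iff[of 0] by (simp flip: zero_ereal_def)
qed (use n in \<open>simp_all add: iwahori_val_grid entry_val_grid\<close>)

lemma pro_p_iwahori_iff:
  "A \<in> pro_p_iwahori n \<longleftrightarrow> A \<in> carrier_mat n n \<and> det A = 1 \<and> mcong n 1 A (1\<^sub>m n)"
proof -
  have iff: "mcong n 1 A (1\<^sub>m n) \<longleftrightarrow> (\<forall>i<n. \<forall>j<n. i < j \<or> padic_prime dvd A $$ (i, j) - 1\<^sub>m n $$ (i, j))"
    unfolding mcong_def by (simp add: wdvd_1_iff del: One_nat_def index_one_mat)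
  have "mcong n 1 A (1\<^sub>m n) \<longleftrightarrow> (\<forall>i<n. padic_prime dvd A $$ (i, i) - 1) \<and> (\<forall>i<n. \<forall>j<i. padic_prime dvd A $$ (i, j))"
    (is "_ \<longleftrightarrow> ?diag \<and> ?low")
  proof
    assume "mcong n 1 A (1\<^sub>m n)"
    then have *: "i < j \<or> padic_prime dvd A $$ (i, j) - 1\<^sub>m n $$ (i, j)" if "i < n" "j < n" for i j
      using that iff by blast
    show "?diag \<and> ?low"
    proof (intro conjI allI impI)
      show "padic_prime dvd A $$ (i, i) - 1" if "i < n" for i
        using *[of i i] that by simp
      show "padic_prime dvd A $$ (i, j)" if "i < n" "j < i" for i j
        using *[of i j] that by simp
    qed
  next
    assume *: "?diag \<and> ?low"
    have "i < j \<or> padic_prime dvd A $$ (i, j) - 1\<^sub>m n $$ (i, j)" if "i < n" "j < n" for i j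
      using * that by (cases i j rule: linorder_cases) simp_all
    then show "mcong n 1 A (1\<^sub>m n)"
      using iff by blast
  qed
  then show ?thesis
    by (auto simp: pro_p_iwahori_def)
qed

section \<open>The listed generators as factors indexed by matrix positions\<close>

definition gen_index :: "nat \<Rightarrow> (nat \<times> nat) list"
  where "gen_index n = neg_root_list n @ map (\<lambda>i. (i, i)) [0..<n - 1] @ pos_root_list n"

text \<open>Replaces each simple root by its diagonal position, so roots and coroots share one index
  set: all positions but the last diagonal one.\<close>

lemma iwahori_gens_eq: "iwahori_gens n = map (gauss_factor n (gen_mat n)) (gen_index n)"
  by (auto simp: iwahori_gens_def gen_index_def simple_root_list_def gauss_factor_def gen_mat_index
      set_neg_root_list set_pos_root_list neg_roots_def pos_roots_def roots_def)

lemma distinct_if_sorted_wrt: "sorted_wrt R xs \<Longrightarrow> (\<And>x. \<not> R x x) \<Longrightarrow> distinct xs"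
  by (induction xs) auto

lemma distinct_neg_root_list: "distinct (neg_root_list n)"
  using sorted_neg_root_list by (rule distinct_if_sorted_wrt) auto

lemma distinct_pos_root_list: "distinct (pos_root_list n)"
  using sorted_pos_root_list by (rule distinct_if_sorted_wrt) auto

lemma gauss_order_full:
  assumes "2 \<le> n"
  shows "gauss_order n (neg_root_list n @ map (\<lambda>i. (i, i)) [0..<n] @ pos_root_list n)"
proof
  show "distinct (neg_root_list n @ map (\<lambda>i. (i, i)) [0..<n] @ pos_root_list n)"
    by (auto simp: distinct_neg_root_list distinct_pos_root_list distinct_map inj_on_def
        set_neg_root_list set_pos_root_list neg_roots_def pos_roots_def)
  show "set (neg_root_list n @ map (\<lambda>i. (i, i)) [0..<n] @ pos_root_list n) = {..<n} \<times> {..<n}"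
    by (auto simp: set_neg_root_list set_pos_root_list neg_roots_def pos_roots_def roots_def)
qed (use assms in simp)

lemma distinct_gen_index: "distinct (gen_index n)"
  by (auto simp: gen_index_def distinct_neg_root_list distinct_pos_root_list distinct_map inj_on_def
      set_neg_root_list set_pos_root_list neg_roots_def pos_roots_def)

lemma set_gen_index: "2 \<le> n \<Longrightarrow> set (gen_index n) = {..<n} \<times> {..<n} - {(n - 1, n - 1)}"
  by (auto simp: gen_index_def set_neg_root_list set_pos_root_list neg_roots_def pos_roots_def roots_def)

lemma length_iwahori_gens: "length (iwahori_gens n) = card (roots n) + card (simple_roots n)"
proof -
  have "length (neg_root_list n) = card (neg_roots n)" "length (pos_root_list n) = card (pos_roots n)"
    using distinct_card[OF distinct_neg_root_list] distinct_card[OF distinct_pos_root_list]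
    by (simp_all add: set_neg_root_list set_pos_root_list)
  moreover have "distinct (simple_root_list n)"
    by (simp add: simple_root_list_def distinct_map inj_on_def)
  then have "length (simple_root_list n) = card (simple_roots n)"
    using distinct_card[of "simple_root_list n"] by (simp add: set_simple_root_list)
  moreover have "roots n = neg_roots n \<union> pos_roots n" "neg_roots n \<inter> pos_roots n = {}"
    by (auto simp: neg_roots_def pos_roots_def roots_def)
  then have "card (roots n) = card (neg_roots n) + card (pos_roots n)"
    using finite_roots[of n] card_Un_disjoint[of "neg_roots n" "pos_roots n"] by simp
  ultimately show ?thesis
    by (simp add: iwahori_gens_def)
qed

section \<open>Bijectivity and the valuation formula\<close>

locale iwahori_coordinates =
  fixes n :: nat and ty :: "'p::prime_card itself"
  assumes n2: "2 \<le> n" and p: "CARD('p) > 2"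
begin

abbreviation "all_index \<equiv> neg_root_list n @ map (\<lambda>i. (i, i)) [0..<n] @ pos_root_list n"

sublocale gauss_order n all_index
  by (rule gauss_order_full[OF n2])

text \<open>The full index list has one more torus position than the list of generators; the zero
  coordinate there makes the extra factor the identity.\<close>

lemma ordered_prod_eq:
  fixes f :: "nat \<times> nat \<Rightarrow> 'p padic_int"
  assumes z: "\<And>k. k < length (gen_index n) \<Longrightarrow> z $ k = f (gen_index n ! k)" and f: "f (n - 1, n - 1) = 0"
  shows "ordered_prod n (iwahori_gens n) z = gprod (coord_mat n f)"
proof -
  let ?G = "gauss_factor n (coord_mat n f)" and ?idx = "gen_index n"
  have len: "length (iwahori_gens n :: 'p padic_int mat list) = length ?idx"
    by (simp add: iwahori_gens_eq)
  have pow: "padic_pow ((iwahori_gens n :: 'p padic_int mat list) ! k) (z $ k) = ?G (?idx ! k)" if "k < length ?idx" for k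
  proof -
    obtain i j where ij: "?idx ! k = (i, j)"
      by fastforce
    then have "(i, j) \<in> set ?idx"
      using that nth_mem by metis
    then have "i < n" "j < n"
      by (auto simp: set_gen_index[OF n2])
    then show ?thesis
      using padic_pow_gauss_factor[OF p, of i n j f] that ij by (simp add: iwahori_gens_eq z)
  qed
  have "ordered_prod n (iwahori_gens n) z = foldr (\<lambda>k A. ?G (?idx ! k) * A) [0..<length ?idx] (1\<^sub>m n)"
    unfolding ordered_prod_def by (rule foldr_cong) (simp_all add: pow len)
  also have "\<dots> = foldr (\<lambda>a A. ?G a * A) (map ((!) ?idx) [0..<length ?idx]) (1\<^sub>m n)"
    by (simp add: foldr_map comp_def)
  also have "\<dots> = list_mat_prod n ?G ?idx"
    by (simp add: map_nth list_mat_prod_def)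
  also have "\<dots> = gprod (coord_mat n f)"
  proof -
    have "?G (n - 1, n - 1) = 1\<^sub>m n"
      using n2 f by (simp add: gauss_factor_def coord_mat_index one_plus_prime_pow_0[OF p] coroot_elt_1)
    moreover have "[0..<n] = [0..<n - 1] @ [n - 1]"
      using n2 by (cases n) auto
    ultimately show ?thesis
      unfolding gen_index_def by (simp add: list_mat_prod_append left_mult_one_mat[OF list_mat_prod_carrier])
  qed
  finally show ?thesis .
qed

lemma coordinates_exist:
  fixes z :: "'p padic_int vec"
  obtains f where "\<And>k. k < length (gen_index n) \<Longrightarrow> z $ k = f (gen_index n ! k)" "f (n - 1, n - 1) = 0"
proof
  let ?idx = "gen_index n"
  \<comment> \<open>The default 0 is what makes the coordinate at the extra position vanish.\<close>
  define f where "f a = (if a \<in> set ?idx then z $ (the_inv_into {..<length ?idx} ((!) ?idx) a) else 0)" for a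
  have "inj_on ((!) ?idx) {..<length ?idx}"
    by (rule inj_on_nth[OF distinct_gen_index]) simp
  then show "z $ k = f (?idx ! k)" if "k < length ?idx" for k
    using that by (simp add: f_def the_inv_into_f_f)
  show "f (n - 1, n - 1) = 0"
    by (simp add: f_def set_gen_index[OF n2])
qed

lemma gprod_coord_eqD:
  fixes f g :: "nat \<times> nat \<Rightarrow> 'p padic_int"
  assumes "gprod (coord_mat n f) = gprod (coord_mat n g)" and ij: "i < n" "j < n"
  shows "f (i, j) = g (i, j)"
proof -
  have "mcong n m (coord_mat n f) (coord_mat n g)" for m
    using gprod_mcong_iff[of "coord_mat n f" "coord_mat n g" m] coord_mat_mcong_0[OF p] assms(1)
    by (simp add: mcong_refl[OF n])
  then have "wdvd n m i j (gen_mat n $$ (i, j) * (f (i, j) - g (i, j)))" for m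
    using ij by (simp add: coord_mat_mcong_iff[OF p])
  then have "gen_mat n $$ (i, j) * (f (i, j) - g (i, j)) = 0"
    by (rule wdvd_imp_0[OF n])
  then have "f (i, j) - g (i, j) = 0"
    using ij padic_prime_mult_left_cancel[of "f (i, j) - g (i, j)" 0] by (simp add: gen_mat_index split: if_splits)
  then show ?thesis
    by simp
qed

lemma bij_ordered_prod:
  "bij_betw (ordered_prod n (iwahori_gens n :: 'p padic_int mat list))
    (carrier_vec (length (iwahori_gens n :: 'p padic_int mat list))) (pro_p_iwahori n)"
proof (rule bij_betw_imageI)
  let ?gs = "iwahori_gens n :: 'p padic_int mat list" and ?idx = "gen_index n"
  have len: "length ?gs = length ?idx"
    by (simp add: iwahori_gens_eq)
  show "inj_on (ordered_prod n ?gs) (carrier_vec (length ?gs))"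
  proof (rule inj_onI)
    fix z w :: "'p padic_int vec"
    assume zw: "z \<in> carrier_vec (length ?gs)" "w \<in> carrier_vec (length ?gs)"
      and eq: "ordered_prod n ?gs z = ordered_prod n ?gs w"
    obtain f where f: "\<And>k. k < length ?idx \<Longrightarrow> z $ k = f (?idx ! k)" "f (n - 1, n - 1) = 0"
      by (rule coordinates_exist[of z]) blast
    obtain g where g: "\<And>k. k < length ?idx \<Longrightarrow> w $ k = g (?idx ! k)" "g (n - 1, n - 1) = 0"
      by (rule coordinates_exist[of w]) blast
    have "gprod (coord_mat n f) = gprod (coord_mat n g)"
      using eq ordered_prod_eq[of z f, OF f] ordered_prod_eq[of w g, OF g] by simp
    note fg = gprod_coord_eqD[OF this]
    show "z = w"
    proof (rule eq_vecI)
      fix k assume "k < dim_vec w"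
      then have k: "k < length ?idx"
        using zw len by simp
      then have "?idx ! k \<in> {..<n} \<times> {..<n}"
        using nth_mem[OF k] by (simp add: set_gen_index[OF n2])
      then have "f (?idx ! k) = g (?idx ! k)"
        using fg by (cases "?idx ! k") simp
      then show "z $ k = w $ k"
        using f(1)[OF k] g(1)[OF k] by simp
    qed (use zw in simp)
  qed
  show "ordered_prod n ?gs ` carrier_vec (length ?gs) = pro_p_iwahori n"
  proof (intro equalityI subsetI)
    fix A assume "A \<in> ordered_prod n ?gs ` carrier_vec (length ?gs)"
    then obtain z where A: "A = ordered_prod n ?gs z"
      by blast
    obtain f where f: "\<And>k. k < length ?idx \<Longrightarrow> z $ k = f (?idx ! k)" "f (n - 1, n - 1) = 0"
      by (rule coordinates_exist[of z]) blast
    have "A = gprod (coord_mat n f)"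
      unfolding A by (rule ordered_prod_eq[OF f])
    then show "A \<in> pro_p_iwahori n"
      using n2 f(2) coord_mat_mcong_0[OF p, of n f]
      by (simp add: pro_p_iwahori_iff det_gprod gprod_cong_1 coord_mat_index one_plus_prime_pow_0[OF p] del: One_nat_def)
  next
    fix A :: "'p padic_int mat" assume "A \<in> pro_p_iwahori n"
    then have A: "A \<in> carrier_mat n n" "det A = 1" "mcong n 1 A (1\<^sub>m n)"
      by (simp_all add: pro_p_iwahori_iff del: One_nat_def)
    obtain B where B: "B \<in> carrier_mat n n" "mcong n 1 B (0\<^sub>m n n)" "gprod B = A"
      using gprod_surj[OF A(1,3)] .
    obtain f where f: "coord_mat n f = B"
      using coord_mat_surj[OF p B(1,2)] .
    have nn: "n - 1 < n"
      using n2 by simp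
    have "1 + B $$ (n - 1, n - 1) = 1"
      using det_gprod[OF B(2)] A(2) B(3) by simp
    \<comment> \<open>Determinant 1 makes the extra parameter trivial; written as a difference from
      (1 + p)^0, it forces the exponent to be divisible by every power of p.\<close>
    then have "one_plus_prime_pow (f (n - 1, n - 1)) - one_plus_prime_pow 0 = 0"
      unfolding f[symmetric] coord_mat_index[OF nn nn] one_plus_prime_pow_0[OF p] by simp
    then have "padic_prime ^ k dvd padic_prime * f (n - 1, n - 1)" for k
      using one_plus_prime_pow_dvd_iff[OF p, of k "f (n - 1, n - 1)" 0] by simp
    then have "f (n - 1, n - 1) = 0"
      by (intro padic_eq_0I) (use padic_prime_mult_dvd_iff in blast)
    then have "ordered_prod n ?gs (vec (length ?gs) (\<lambda>k. f (?idx ! k))) = A"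
      using ordered_prod_eq[of "vec (length ?gs) (\<lambda>k. f (?idx ! k))" f] by (simp add: len f B(3))
    then show "A \<in> ordered_prod n ?gs ` carrier_vec (length ?gs)"
      by (intro image_eqI[of _ _ "vec (length ?gs) (\<lambda>k. f (?idx ! k))"]) auto
  qed
qed

text \<open>Both sides reach the threshold m/n under the same condition: every parameter lies at
  level m in its position. For the product this is \<open>gprod_mcong_iff\<close> compared with zero
  coordinates, for the minimum it is \<open>le_entry_val_iff\<close>.\<close>

lemma iwahori_val_ordered_prod:
  fixes z :: "'p padic_int vec"
  shows "iwahori_val n (ordered_prod n (iwahori_gens n) z) =
    (MIN i\<in>{..<length (iwahori_gens n :: 'p padic_int mat list)}.
      iwahori_val n ((iwahori_gens n :: 'p padic_int mat list) ! i) + ereal_of_enat (padic_val (z $ i)))"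
    (is "?x = ?y")
proof -
  let ?gs = "iwahori_gens n :: 'p padic_int mat list" and ?idx = "gen_index n"
  have len: "length ?gs = length ?idx"
    by (simp add: iwahori_gens_eq)
  obtain f where f: "\<And>k. k < length ?idx \<Longrightarrow> z $ k = f (?idx ! k)" "f (n - 1, n - 1) = 0"
    by (rule coordinates_exist[of z]) blast
  let ?t = "\<lambda>(i, j). ereal (real_of_int (height (i, j)) / real n) + ereal_of_enat (padic_val (gen_mat n $$ (i, j) * f (i, j)))"
  have "iwahori_val n (?gs ! k) + ereal_of_enat (padic_val (z $ k)) = ?t (?idx ! k)" if k: "k < length ?idx" for k
  proof -
    obtain i j where ij: "?idx ! k = (i, j)"
      by fastforce
    then have ij': "i < n" "j < n"
      using nth_mem[OF k] by (auto simp: set_gen_index[OF n2])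
    show ?thesis
      using k f(1)[OF k] ij
      by (simp add: iwahori_gens_eq iwahori_val_gen[OF n2 ij'] padic_val_gen_mat_mult[OF ij'] ereal_of_enat_add add.assoc)
  qed
  then have "?y = Min ((\<lambda>k. ?t (?idx ! k)) ` {..<length ?idx})"
    unfolding len by (intro arg_cong[of _ _ Min] image_cong) auto
  also have "(\<lambda>k. ?t (?idx ! k)) ` {..<length ?idx} = ?t ` set ?idx"
    by (simp only: set_conv_nth image_image lessThan_def setcompr_eq_image)
  finally have y: "?y = Min (?t ` set ?idx)" .
  have x: "?x = iwahori_val n (gprod (coord_mat n f))"
    by (simp add: ordered_prod_eq[OF f])
  have "(0, 1) \<in> set ?idx"
    using n2 by (simp add: set_gen_index[OF n2])
  then have "set ?idx \<noteq> {}"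
    by (metis empty_iff)
  then have ne: "?t ` set ?idx \<noteq> {}" "finite (?t ` set ?idx)"
    by simp_all
  have iff: "ereal (real m / real n) \<le> ?x \<longleftrightarrow> ereal (real m / real n) \<le> ?y" for m
  proof -
    have "ereal (real m / real n) \<le> ?x \<longleftrightarrow> mcong n m (gprod (coord_mat n f)) (gprod (coord_mat n (\<lambda>_. 0 :: 'p padic_int)))"
      unfolding x le_iwahori_val_iff[OF n2] by (simp add: coord_mat_0[OF p] gprod_0)
    also have "\<dots> \<longleftrightarrow> mcong n m (coord_mat n f) (coord_mat n (\<lambda>_. 0))"
      by (rule gprod_mcong_iff) (simp_all add: coord_mat_mcong_0[OF p] del: One_nat_def)
    also have "\<dots> \<longleftrightarrow> (\<forall>i<n. \<forall>j<n. wdvd n m i j (gen_mat n $$ (i, j) * f (i, j)))"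
      by (simp add: coord_mat_mcong_iff[OF p])
    also have "\<dots> \<longleftrightarrow> (\<forall>(i, j)\<in>set ?idx. wdvd n m i j (gen_mat n $$ (i, j) * f (i, j)))"
    proof -
      \<comment> \<open>The extra position imposes no condition, so the quantifier can be restricted
        to the generators.\<close>
      have "wdvd n m (n - 1) (n - 1) (gen_mat n $$ (n - 1, n - 1) * f (n - 1, n - 1))"
        using f(2) by (simp add: wdvd_0[OF n])
      then show ?thesis
        unfolding set_gen_index[OF n2] by blast
    qed
    also have "\<dots> \<longleftrightarrow> ereal (real m / real n) \<le> ?y"
      unfolding y Min_ge_iff[OF ne(2,1)] ball_simps using le_entry_val_iff[OF n, of m] by auto
    finally show ?thesis .
  qed
  show ?thesis
  proof (rule grid_eqI[OF n])
    show "?x \<in> grid n"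
      by (rule iwahori_val_grid[OF n2])
    show "?y \<in> grid n"
      unfolding y using Min_in[OF ne(2,1)] entry_val_grid[OF n] by auto
    \<comment> \<open>Supplies the nonnegativity that \<open>grid_eqI\<close> asks for; the
      threshold equivalence at m = 0 then carries it over to the minimum.\<close>
    have "mcong n 0 (gprod (coord_mat n f)) (1\<^sub>m n)"
      using gprod_cong_1[OF coord_mat_mcong_0[OF p]] by (rule mcong_mono) simp
    then show "0 \<le> ?x"
      using le_iwahori_val_iff[OF n2, of 0 "gprod (coord_mat n f)"] by (simp add: x flip: zero_ereal_def)
    then show "0 \<le> ?y"
      using iff[of 0] by (simp flip: zero_ereal_def)
  qed (rule iff)
qed

end

theorem theorem2p5:
  fixes n :: nat
  assumes "n \<ge> 2"
    and "CARD('p::prime_card) > n + 1"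
  shows "length (iwahori_gens n :: 'p padic_int mat list) = card (roots n) + card (simple_roots n) \<and>
    ordered_basis n (pro_p_iwahori n) (iwahori_val n) (iwahori_gens n :: 'p padic_int mat list)"
proof -
  interpret iwahori_coordinates n "TYPE('p)"
    by unfold_locales (use assms in simp_all)
  show ?thesis
    unfolding ordered_basis_def
    using length_iwahori_gens bij_ordered_prod iwahori_val_ordered_prod by blast
qed

end
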